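(* Let the $n\times p$ matrix $X$ have independent rows $X^{(i)}\sim\mathcal N_p(0,\Sigma_0)$, $i=1,\dots,n$, with precision matrix $\Theta_0:=\Sigma_0^{-1}$. Assume that $\Theta_0\in\mathcal G(d_1,\dots,d_p)$ where $\max_{j=1,\dots,p}d_j=o(\sqrt n/\log p)$. Let $\xi_1,\xi_2\in\mathbb R^p$ be known vectors, and set $$\sigma^2:=\xi_1^T\Theta_0\xi_1\;\xi_2^T\Theta_0\xi_2+(\xi_1^T\Theta_0\xi_2)^2,\qquad H:=\Theta_0(\xi_1\xi_2^T+\xi_2\xi_1^T)\Theta_0/\sigma .$$ Assume that $\Theta_0+H/\sqrt n\in B(\Theta_0,c/\sqrt n)$ and that $T_n$ is a strongly asymptotically unbiased estimator of $g(\Theta)=\xi_1^T\Theta\xi_2$ at $\Theta_0$ in the direction $H$. Then $$\mathrm{var}_{\Theta_0}(T_n)\ \ge\ \frac{\sigma^2-o(1)}{n}.$$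
   Context: Asymptotic regime: $n\to\infty$, $p=p_n$ may depend on $n$ (possibly $p\gg n$), and all parameters ($\Theta_0,\xi_1,\xi_2,d_j,\dots$) are sequences that may depend on $n$, the index being suppressed; $\mathcal O(\cdot)$, $o(\cdot)$ refer to $n\to\infty$. $\|x\|_0$ is the number of non-zero entries of $x$; $\|\cdot\|_F$ is the Frobenius norm; $\Lambda_{\min},\Lambda_{\max}$ are extreme eigenvalues; $\Theta_j$ is the $j$-th column of $\Theta$. Parameter set: $\mathcal T\subset\mathbb R^{p\times p}$ is a parameter space, $C_1,C_2,C_3,c>0$ are universal constants (independent of $n,p$), and $$\mathcal G(d_1,\dots,d_p):=\{\Theta\in\mathcal T:\Theta=\Theta^T,\ \|\Theta_j\|_0\le C_1d_j\ (j=1,\dots,p),\ 1/\Lambda_{\min}(\Theta)\le C_2,\ \Lambda_{\max}(\Theta)\le C_3\},$$ $$B(\Theta,\varepsilon):=\{\tilde\Theta\in\mathcal G(d_1,\dots,d_p):\|\tilde\Theta-\Theta\|_F\le\varepsilon\}.$$ $\mathbb E_\Theta,\mathrm{var}_\Theta$ denote expectation and variance when the rows of $X$ are i.i.d. $\mathcal N_p(0,\Theta^{-1})$; an estimator is a measurable function of $X$. Strong asymptotic unbiasedness of $T_n$ for $g(\Theta)$ at $\Theta_0$ in the direction $H$ means: for some sequence $m_n$ with $n=o(m_n)$, $\mathrm{var}_{\Theta_0}(T_n)=\mathcal O(1/n)$ and $\lim_{n\to\infty}\sqrt{m_n}(\mathbb E_\Theta T_n-g(\Theta))=0$ both for $\Theta=\Theta_0$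 and for $\Theta=\Theta_0+H/\sqrt{m_n}$. *)

theory Defs
  imports
    "HOL-Probability.Probability"
    "HOL-Library.Landau_Symbols"
    "Jordan_Normal_Form.Gauss_Jordan_Elimination"
    "Jordan_Normal_Form.Spectral_Radius"
begin

text \<open>
  Since the dimension varies with the sample size, matrices and vectors carry their dimensions
  at run time. Indices run over \<open>{..<p}\<close> and \<open>{..<n}\<close>.
\<close>

definition mat_inv :: "real Matrix.mat \<Rightarrow> real Matrix.mat" where
  "mat_inv A = the (mat_inverse A)"

definition bilin :: "real Matrix.vec \<Rightarrow> real Matrix.mat \<Rightarrow> real Matrix.vec \<Rightarrow> real" where
  "bilin u A v = scalar_prod u (mult_mat_vec A v)"

definition outer_prod :: "real Matrix.vec \<Rightarrow> real Matrix.vec \<Rightarrow> real Matrix.mat" where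
  "outer_prod u v = Matrix.mat (dim_vec u) (dim_vec v) (\<lambda>(i, j). vec_index u i * vec_index v j)"

definition l0_norm :: "real Matrix.vec \<Rightarrow> nat" where
  "l0_norm v = card {i. i < dim_vec v \<and> vec_index v i \<noteq> 0}"

definition frob_norm :: "real Matrix.mat \<Rightarrow> real" where
  "frob_norm A = sqrt (\<Sum>i<dim_row A. \<Sum>j<dim_col A. (A $$ (i, j))\<^sup>2)"

definition Lambda_min :: "real Matrix.mat \<Rightarrow> real" where
  "Lambda_min A = Min (spectrum A)"

definition Lambda_max :: "real Matrix.mat \<Rightarrow> real" where
  "Lambda_max A = Max (spectrum A)"

text \<open>
  The centred normal law with nonsingular covariance matrix \<open>S\<close>, given by its Lebesgue density
  on \<open>\<real>\<^sup>p\<close> (functions on \<open>{..<p}\<close>).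
\<close>

definition normal_law :: "nat \<Rightarrow> real Matrix.mat \<Rightarrow> (nat \<Rightarrow> real) measure" where
  "normal_law p S = density (\<Pi>\<^sub>M j\<in>{..<p}. lborel)
     (\<lambda>x. ennreal (exp (- bilin (Matrix.vec p x) (mat_inv S) (Matrix.vec p x) / 2)
                    / sqrt ((2 * pi) ^ p * Determinant.det S)))"

text \<open>
  The law of the data matrix \<open>X\<close> (entries \<open>X i j\<close>) under the precision matrix \<open>\<Theta>\<close>: \<open>n\<close> independent
  rows with covariance matrix the inverse of \<open>\<Theta>\<close>.
\<close>

definition data_law :: "nat \<Rightarrow> nat \<Rightarrow> real Matrix.mat \<Rightarrow> (nat \<Rightarrow> nat \<Rightarrow> real) measure" where
  "data_law n p \<Theta> = (\<Pi>\<^sub>M i\<in>{..<n}. normal_law p (mat_inv \<Theta>))"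

definition estimator :: "nat \<Rightarrow> nat \<Rightarrow> ((nat \<Rightarrow> nat \<Rightarrow> real) \<Rightarrow> real) \<Rightarrow> bool" where
  "estimator n p t \<longleftrightarrow> t \<in> borel_measurable (\<Pi>\<^sub>M i\<in>{..<n}. \<Pi>\<^sub>M j\<in>{..<p}. (borel :: real measure))"

definition mean_under :: "nat \<Rightarrow> nat \<Rightarrow> real Matrix.mat \<Rightarrow> ((nat \<Rightarrow> nat \<Rightarrow> real) \<Rightarrow> real) \<Rightarrow> real" where
  "mean_under n p \<Theta> t = (\<integral>x. t x \<partial>data_law n p \<Theta>)"

definition var_under :: "nat \<Rightarrow> nat \<Rightarrow> real Matrix.mat \<Rightarrow> ((nat \<Rightarrow> nat \<Rightarrow> real) \<Rightarrow> real) \<Rightarrow> real" where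
  "var_under n p \<Theta> t = (\<integral>x. (t x - mean_under n p \<Theta> t)\<^sup>2 \<partial>data_law n p \<Theta>)"

text \<open>
  The parameter set. Its elements are precision matrices, so the bound on the inverse of the
  smallest eigenvalue is understood with that eigenvalue positive; this has to be said,
  because \<open>1 / x \<le> C2\<close> also holds for every \<open>x \<le> 0\<close>.
\<close>

definition param_set ::
  "nat \<Rightarrow> real Matrix.mat set \<Rightarrow> (nat \<Rightarrow> real) \<Rightarrow> real \<Rightarrow> real \<Rightarrow> real \<Rightarrow> real Matrix.mat set" where
  "param_set p \<T> d C1 C2 C3 = {\<Theta> \<in> \<T>. \<Theta> \<in> carrier_mat p p \<and> transpose_mat \<Theta> = \<Theta> \<and>
     (\<forall>j<p. real (l0_norm (col \<Theta> j)) \<le> C1 * d j) \<and>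
     0 < Lambda_min \<Theta> \<and> 1 / Lambda_min \<Theta> \<le> C2 \<and> Lambda_max \<Theta> \<le> C3}"

definition param_ball ::
  "nat \<Rightarrow> real Matrix.mat set \<Rightarrow> (nat \<Rightarrow> real) \<Rightarrow> real \<Rightarrow> real \<Rightarrow> real \<Rightarrow>
   real Matrix.mat \<Rightarrow> real \<Rightarrow> real Matrix.mat set" where
  "param_ball p \<T> d C1 C2 C3 \<Theta> \<epsilon> = {\<Theta>' \<in> param_set p \<T> d C1 C2 C3. frob_norm (\<Theta>' - \<Theta>) \<le> \<epsilon>}"

text \<open>
  Strong asymptotic unbiasedness of the estimators \<open>T n\<close> for \<open>g n \<Theta>\<close> at \<open>\<Theta>\<^sub>0 n\<close> in the direction
  \<open>H n\<close>. Bochner integrals of non-integrable functions are \<open>0\<close>, so the finiteness of the moments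
  that occur is required explicitly (for all large \<open>n\<close>).
\<close>

definition strongly_asymp_unbiased ::
  "(nat \<Rightarrow> nat) \<Rightarrow> (nat \<Rightarrow> (nat \<Rightarrow> nat \<Rightarrow> real) \<Rightarrow> real) \<Rightarrow> (nat \<Rightarrow> real Matrix.mat \<Rightarrow> real) \<Rightarrow>
   (nat \<Rightarrow> real Matrix.mat) \<Rightarrow> (nat \<Rightarrow> real Matrix.mat) \<Rightarrow> bool" where
  "strongly_asymp_unbiased p T g \<Theta>\<^sub>0 H \<longleftrightarrow>
     (\<forall>\<^sub>F n in sequentially. integrable (data_law n (p n) (\<Theta>\<^sub>0 n)) (\<lambda>x. (T n x)\<^sup>2)) \<and>
     (\<lambda>n. var_under n (p n) (\<Theta>\<^sub>0 n) (T n)) \<in> O(\<lambda>n. 1 / real n) \<and>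
     (\<exists>m :: nat \<Rightarrow> real. (\<forall>n. 0 < m n) \<and> (\<lambda>n. real n) \<in> o(m) \<and>
        (\<forall>\<Theta> \<in> {\<Theta>\<^sub>0, (\<lambda>n. \<Theta>\<^sub>0 n + (1 / sqrt (m n)) \<cdot>\<^sub>m H n)}.
           (\<forall>\<^sub>F n in sequentially. integrable (data_law n (p n) (\<Theta> n)) (T n)) \<and>
           (\<lambda>n. sqrt (m n) * (mean_under n (p n) (\<Theta> n) (T n) - g n (\<Theta> n))) \<longlonglongrightarrow> 0))"

definition sigma_of :: "real Matrix.mat \<Rightarrow> real Matrix.vec \<Rightarrow> real Matrix.vec \<Rightarrow> real" where
  "sigma_of \<Theta> u v = sqrt (bilin u \<Theta> u * bilin v \<Theta> v + (bilin u \<Theta> v)\<^sup>2)"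

text \<open>
  If \<open>u\<close> or \<open>v\<close> is zero then so is \<open>sigma_of \<Theta> u v\<close>, and the direction is the zero matrix.
\<close>

definition direction_of :: "real Matrix.mat \<Rightarrow> real Matrix.vec \<Rightarrow> real Matrix.vec \<Rightarrow> real Matrix.mat" where
  "direction_of \<Theta> u v = (1 / sigma_of \<Theta> u v) \<cdot>\<^sub>m (\<Theta> * (outer_prod u v + outer_prod v u) * \<Theta>)"

end

theory Submission
  imports Defs
begin

text \<open>
  The bound is the Chapman--Robbins inequality between \<open>\<Theta>\<^sub>0\<close> and \<open>\<Theta>\<^sub>0 + H / \<surd>m\<close>. With \<open>L\<close> the likelihood
  ratio of the two data laws, Cauchy--Schwarz gives
  \<open>(E\<^sub>1 T - E\<^sub>0 T)\<^sup>2 \<le> var\<^sub>0 T * (E\<^sub>0 L\<^sup>2 - 1)\<close>. Unbiasedness and \<open>\<xi>\<^sub>1\<^sup>T H \<xi>\<^sub>2 = \<sigma>\<close> turn the left-hand side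
  into \<open>(\<sigma> + o(1))\<^sup>2 / m\<close>. As \<open>H\<close> has rank two, \<open>E\<^sub>0 L\<^sup>2\<close> is an explicit Gaussian integral, an \<open>n\<close>-th power
  of a quotient of determinants depending on \<open>\<xi>\<^sub>1\<^sup>T \<Theta>\<^sub>0 \<xi>\<^sub>2 / \<sigma>\<close> only, and the normalisation of \<open>H\<close>
  makes \<open>E\<^sub>0 L\<^sup>2 - 1 \<le> (1 + o(1)) n / m\<close> because \<open>n / m \<rightarrow> 0\<close>. Finally \<open>var\<^sub>0 T = O(1 / n)\<close> forces
  \<open>\<sigma>\<close> to stay bounded, which absorbs the error terms.
\<close>

section \<open>Bilinear forms and positive definite matrices\<close>

text \<open>Symmetry is built in because positivity of a real quadratic form does not force it,
  while Cauchy--Schwarz and the Schur complement below rely on it.\<close>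

definition pos_def :: "nat \<Rightarrow> real Matrix.mat \<Rightarrow> bool" where
  "pos_def p A \<longleftrightarrow> A \<in> carrier_mat p p \<and> transpose_mat A = A \<and>
     (\<forall>x \<in> carrier_vec p. x \<noteq> 0\<^sub>v p \<longrightarrow> 0 < bilin x A x)"

lemma transpose_eq_self_iff:
  assumes "A \<in> carrier_mat p p"
  shows "transpose_mat A = A \<longleftrightarrow> (\<forall>i<p. \<forall>j<p. A $$ (i, j) = A $$ (j, i))"
proof
  assume "transpose_mat A = A"
  then show "\<forall>i<p. \<forall>j<p. A $$ (i, j) = A $$ (j, i)"
    using assms by (metis carrier_matD index_transpose_mat(1))
next
  assume *: "\<forall>i<p. \<forall>j<p. A $$ (i, j) = A $$ (j, i)"
  show "transpose_mat A = A"
    by (rule eq_matI) (use assms * in auto)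
qed

lemma bilin_eq_sum:
  assumes "A \<in> carrier_mat p q" "x \<in> carrier_vec p" "y \<in> carrier_vec q"
  shows "bilin x A y = (\<Sum>i<p. \<Sum>j<q. vec_index x i * A $$ (i, j) * vec_index y j)"
  using assms
  by (auto simp: bilin_def scalar_prod_def sum_distrib_left atLeast0LessThan mult.assoc intro!: sum.cong)

lemma bilin_commute:
  assumes "A \<in> carrier_mat p p" "transpose_mat A = A" "x \<in> carrier_vec p" "y \<in> carrier_vec p"
  shows "bilin x A y = bilin y A x"
proof -
  have "bilin x A y = scalar_prod (mult_mat_vec A x) y"
    unfolding bilin_def using transpose_vec_mult_scalar[OF assms(1,4,3)] assms(2) by simp
  also have "\<dots> = bilin y A x"
    unfolding bilin_def using assms by (intro comm_scalar_prod[of _ p]) auto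
  finally show ?thesis .
qed

lemma bilin_add_left:
  assumes "A \<in> carrier_mat p p" "x \<in> carrier_vec p" "y \<in> carrier_vec p" "z \<in> carrier_vec p"
  shows "bilin (x + y) A z = bilin x A z + bilin y A z"
  using assms unfolding bilin_def by (intro add_scalar_prod_distrib[of _ p]) auto

lemma bilin_add_right:
  assumes "A \<in> carrier_mat p p" "x \<in> carrier_vec p" "y \<in> carrier_vec p" "z \<in> carrier_vec p"
  shows "bilin z A (x + y) = bilin z A x + bilin z A y"
  using assms unfolding bilin_def 
  by (simp add: mult_add_distrib_mat_vec[of _ p p] scalar_prod_add_distrib[of _ p])

lemma bilin_smult_left:
  assumes "A \<in> carrier_mat p p" "x \<in> carrier_vec p" "y \<in> carrier_vec p"
  shows "bilin (c \<cdot>\<^sub>v x) A y = c * bilin x A y"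
  using assms unfolding bilin_def by (intro smult_scalar_prod_distrib[of _ p]) auto

lemma bilin_smult_right:
  assumes "A \<in> carrier_mat p p" "x \<in> carrier_vec p" "y \<in> carrier_vec p"
  shows "bilin x A (c \<cdot>\<^sub>v y) = c * bilin x A y"
  using assms unfolding bilin_def by (simp add: mult_mat_vec[of _ p p])

lemma bilin_add_mat:
  assumes "A \<in> carrier_mat p p" "B \<in> carrier_mat p p" "x \<in> carrier_vec p" "y \<in> carrier_vec p"
  shows "bilin x (A + B) y = bilin x A y + bilin x B y"
  using assms by (simp add: bilin_eq_sum[of _ p p] algebra_simps sum.distrib)

lemma bilin_smult_mat:
  assumes "A \<in> carrier_mat p p" "x \<in> carrier_vec p" "y \<in> carrier_vec p"
  shows "bilin x (c \<cdot>\<^sub>m A) y = c * bilin x A y"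
  using assms by (simp add: bilin_eq_sum[of _ p p] algebra_simps sum_distrib_left)

text \<open>For \<open>c > 0\<close>, evaluate at the minimiser \<open>t = - b / c\<close>; for
  \<open>c = 0\<close> the expression is affine in \<open>t\<close>, so its slope must vanish. This
  serves Cauchy--Schwarz both for matrix forms and for integrals.\<close>

lemma quadratic_nonneg_discriminant:
  fixes a b c :: real
  assumes "\<And>t. 0 \<le> a + 2 * t * b + t\<^sup>2 * c" "0 \<le> c"
  shows "b\<^sup>2 \<le> a * c"
proof (cases "c = 0")
  case True
  have "b = 0"
  proof (rule ccontr)
    assume "b \<noteq> 0"
    \<comment> \<open>At this \<open>t\<close> the affine function \<open>a + 2 * t * b\<close>
      equals \<open>- 1\<close>.\<close>
    with assms(1)[of "- (a + 1) / (2 * b)"] True show False by (simp add: field_simps)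
  qed
  with True show ?thesis by simp
next
  case False
  with assms have c: "0 < c" by simp
  have "0 \<le> c * (a + 2 * (- b / c) * b + (- b / c)\<^sup>2 * c)"
    using assms(1)[of "- b / c"] c by simp
  also have "\<dots> = a * c - b\<^sup>2"
    using c by (simp add: field_simps power2_eq_square)
  finally show ?thesis by simp
qed

text \<open>Only semidefiniteness is assumed, since the shifted form \<open>A + s I\<close> below is
  not yet known to be definite when this is applied to it.\<close>

lemma bilin_Cauchy_Schwarz:
  assumes A: "A \<in> carrier_mat p p" "transpose_mat A = A"
    and nonneg: "\<And>x. x \<in> carrier_vec p \<Longrightarrow> 0 \<le> bilin x A x"
    and x: "x \<in> carrier_vec p" and y: "y \<in> carrier_vec p"
  shows "(bilin x A y)\<^sup>2 \<le> bilin x A x * bilin y A y"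
proof (rule quadratic_nonneg_discriminant)
  fix t
  have "0 \<le> bilin (x + t \<cdot>\<^sub>v y) A (x + t \<cdot>\<^sub>v y)"
    using x y by (intro nonneg) auto
  also have "\<dots> = bilin x A x + 2 * t * bilin x A y + t\<^sup>2 * bilin y A y"
    using A x y bilin_commute[OF A x y]
    by (simp add: bilin_add_left[of _ p] bilin_add_right[of _ p] bilin_smult_left[of _ p]
        bilin_smult_right[of _ p] algebra_simps power2_eq_square)
  finally show "0 \<le> bilin x A x + 2 * t * bilin x A y + t\<^sup>2 * bilin y A y" .
qed (use nonneg y in auto)

lemma scalar_prod_self_real:
  fixes x :: "real Matrix.vec"
  assumes "x \<in> carrier_vec p"
  shows "scalar_prod x x = (\<Sum>i<p. (vec_index x i)\<^sup>2)"
  using assms by (auto simp: scalar_prod_def atLeast0LessThan power2_eq_square)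

lemma scalar_prod_self_nonneg:
  fixes x :: "real Matrix.vec"
  shows "0 \<le> scalar_prod x x"
  by (auto simp: scalar_prod_def intro!: sum_nonneg)

lemma scalar_prod_self_pos:
  fixes x :: "real Matrix.vec"
  assumes x: "x \<in> carrier_vec p" and "x \<noteq> 0\<^sub>v p"
  shows "0 < scalar_prod x x"
proof (rule ccontr)
  assume "\<not> 0 < scalar_prod x x"
  then have "(\<Sum>i<p. (vec_index x i)\<^sup>2) = 0"
    using scalar_prod_self_nonneg[of x] scalar_prod_self_real[OF x] by simp
  then have "\<forall>i<p. vec_index x i = 0"
    by (subst (asm) sum_nonneg_eq_0_iff) auto
  then have "x = 0\<^sub>v p" using x by (intro eq_vecI) auto
  with assms(2) show False by simp
qed

text \<open>Each product \<open>\<bar>x i\<bar> * \<bar>x j\<bar>\<close> is at most the squared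
  length of \<open>x\<close>, so the sum of the absolute entries is a bound; the extra 1 keeps it
  positive even for the zero matrix.\<close>

lemma bilin_bounded:
  assumes A: "A \<in> carrier_mat p p"
  obtains K where "0 < K" "\<And>x. x \<in> carrier_vec p \<Longrightarrow> \<bar>bilin x A x\<bar> \<le> K * scalar_prod x x"
proof
  let ?K = "1 + (\<Sum>i<p. \<Sum>j<p. \<bar>A $$ (i, j)\<bar>)"
  show "0 < ?K" by (intro add_pos_nonneg sum_nonneg) auto
  fix x :: "real Matrix.vec" assume x: "x \<in> carrier_vec p"
  have entry: "\<bar>vec_index x i\<bar> * \<bar>vec_index x j\<bar> \<le> scalar_prod x x" if "i < p" "j < p" for i j
  proof -
    have "(vec_index x k)\<^sup>2 \<le> scalar_prod x x" if "k < p" for k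
      unfolding scalar_prod_self_real[OF x] using that by (intro member_le_sum) auto
    then have "\<bar>vec_index x k\<bar> \<le> sqrt (scalar_prod x x)" if "k < p" for k
      using that real_le_rsqrt by fastforce
    then have "\<bar>vec_index x i\<bar> * \<bar>vec_index x j\<bar> \<le> sqrt (scalar_prod x x) * sqrt (scalar_prod x x)"
      using that by (intro mult_mono) (auto simp: scalar_prod_self_nonneg)
    then show ?thesis by (simp add: scalar_prod_self_nonneg)
  qed
  have "\<bar>bilin x A x\<bar> \<le> (\<Sum>i<p. \<Sum>j<p. \<bar>vec_index x i * A $$ (i, j) * vec_index x j\<bar>)"
    unfolding bilin_eq_sum[OF A x x]
    by (rule order_trans[OF sum_abs]) (intro sum_mono sum_abs)
  also have "\<dots> \<le> (\<Sum>i<p. \<Sum>j<p. \<bar>A $$ (i, j)\<bar> * scalar_prod x x)"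
  proof (intro sum_mono)
    fix i j assume "i \<in> {..<p}" "j \<in> {..<p}"
    then show "\<bar>vec_index x i * A $$ (i, j) * vec_index x j\<bar> \<le> \<bar>A $$ (i, j)\<bar> * scalar_prod x x"
      using mult_left_mono[OF entry, of i j "\<bar>A $$ (i, j)\<bar>"] by (simp add: abs_mult ac_simps)
  qed
  also have "\<dots> \<le> ?K * scalar_prod x x"
    by (simp add: algebra_simps sum_distrib_right sum_distrib_left scalar_prod_self_nonneg)
  finally show "\<bar>bilin x A x\<bar> \<le> ?K * scalar_prod x x" .
qed

section \<open>Inverses of nonsingular matrices and their determinants\<close>

lemma mat_inv_det_nonzero:
  fixes A :: "real Matrix.mat"
  assumes A: "A \<in> carrier_mat p p" and det: "Determinant.det A \<noteq> 0"
  shows "mat_inv A \<in> carrier_mat p p" "A * mat_inv A = 1\<^sub>m p" "mat_inv A * A = 1\<^sub>m p"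
proof -
  have "mat_inverse A \<noteq> None"
    using mat_inverse(1)[OF A, of "()"] det_non_zero_imp_unit[OF A det, of "()"] by blast
  then have "mat_inverse A = Some (mat_inv A)"
    by (auto simp: mat_inv_def)
  from mat_inverse(2)[OF A this]
  show "mat_inv A \<in> carrier_mat p p" "A * mat_inv A = 1\<^sub>m p" "mat_inv A * A = 1\<^sub>m p" by auto
qed

lemma det_mat_inv:
  fixes A :: "real Matrix.mat"
  assumes A: "A \<in> carrier_mat p p" and det: "Determinant.det A \<noteq> 0"
  shows "Determinant.det (mat_inv A) = 1 / Determinant.det A"
proof -
  have "Determinant.det A * Determinant.det (mat_inv A) = 1"
    using det_mult[OF A mat_inv_det_nonzero(1)[OF assms]] mat_inv_det_nonzero(2)[OF assms] by simp
  with det show ?thesis by (simp add: field_simps)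
qed

text \<open>\<open>data_law\<close> hands the covariance \<open>mat_inv \<Theta>\<close> to
  \<open>normal_law\<close>, which inverts it again; this recovers the precision matrix in the
  density.\<close>

lemma mat_inv_mat_inv:
  assumes A: "A \<in> carrier_mat p p" and det: "Determinant.det A \<noteq> 0"
  shows "mat_inv (mat_inv A) = A"
proof -
  note inv = mat_inv_det_nonzero[OF A det]
  have "Determinant.det (mat_inv A) \<noteq> 0" using det_mat_inv[OF A det] det by simp
  note inv2 = mat_inv_det_nonzero[OF inv(1) this]
  have "mat_inv (mat_inv A) = (A * mat_inv A) * mat_inv (mat_inv A)"
    using inv inv2 by simp
  also have "\<dots> = A" using A inv(1) inv2 by (simp add: assoc_mult_mat[of _ p p _ p _ p])
  finally show ?thesis .
qed

text \<open>
  Shifting by the least \<open>s \<ge> 0\<close> that makes \<open>A + s I\<close> positive semidefinite gives a nonsingular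
  form, which Cauchy--Schwarz bounds away from zero; so the shift can only be \<open>0\<close>. This replaces
  the spectral theorem.
\<close>

lemma pos_def_if_eigenvalues_pos:
  assumes A: "A \<in> carrier_mat p p" "transpose_mat A = A"
    and eig: "\<And>k. eigenvalue A k \<Longrightarrow> 0 < k"
  shows "pos_def p A"
proof -
  define S where "S = {s. 0 \<le> s \<and> (\<forall>x \<in> carrier_vec p. 0 \<le> bilin x A x + s * scalar_prod x x)}"
  define s where "s = Inf S"
  obtain L where L: "0 < L" "\<And>x. x \<in> carrier_vec p \<Longrightarrow> \<bar>bilin x A x\<bar> \<le> L * scalar_prod x x"
    using bilin_bounded[OF A(1)] by blast
  have "L \<in> S" unfolding S_def using L by (force simp: abs_le_iff)
  then have ne: "S \<noteq> {}" by auto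
  have bdd: "bdd_below S" by (rule bdd_belowI[of _ 0]) (auto simp: S_def)
  have s0: "0 \<le> s" unfolding s_def using ne by (intro cInf_greatest) (auto simp: S_def)
  \<comment> \<open>The infimum \<open>s\<close> is itself an admissible shift: for a fixed nonzero
    \<open>x\<close> the condition on the shift is a lower bound by
    \<open>- bilin x A x / scalar_prod x x\<close>.\<close>
  have psd: "0 \<le> bilin x A x + s * scalar_prod x x" if x: "x \<in> carrier_vec p" for x
  proof (cases "scalar_prod x x = 0")
    case True
    with \<open>L \<in> S\<close> x show ?thesis unfolding S_def by force
  next
    case False
    then have pos: "0 < scalar_prod x x" using scalar_prod_self_nonneg[of x] by simp
    have "- bilin x A x / scalar_prod x x \<le> s"
      unfolding s_def
    proof (rule cInf_greatest[OF ne])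
      fix r assume "r \<in> S"
      with x have "0 \<le> bilin x A x + r * scalar_prod x x" by (auto simp: S_def)
      with pos show "- bilin x A x / scalar_prod x x \<le> r" by (simp add: field_simps)
    qed
    with pos show ?thesis by (simp add: field_simps)
  qed
  define B where "B = A + s \<cdot>\<^sub>m 1\<^sub>m p"
  have B: "B \<in> carrier_mat p p" "transpose_mat B = B"
    using A unfolding B_def by (auto simp: transpose_add[of _ p p])
  have Bv: "mult_mat_vec B v = mult_mat_vec A v + s \<cdot>\<^sub>v v" if "v \<in> carrier_vec p" for v
  proof -
    have "mult_mat_vec (s \<cdot>\<^sub>m 1\<^sub>m p) v = s \<cdot>\<^sub>v v"
      using that by (intro eq_vecI) auto
    then show ?thesis
      unfolding B_def using that A by (simp add: add_mult_distrib_mat_vec[of _ p p])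
  qed
  have BB: "bilin x B x = bilin x A x + s * scalar_prod x x" if "x \<in> carrier_vec p" for x
    unfolding bilin_def Bv[OF that] using that A by (simp add: scalar_prod_add_distrib[of _ p])
  \<comment> \<open>A kernel vector of \<open>B\<close> would be an eigenvector of \<open>A\<close>
    for \<open>- s \<le> 0\<close>, against \<open>eig\<close>.\<close>
  have "Determinant.det B \<noteq> 0"
  proof
    assume "Determinant.det B = 0"
    then obtain v where v: "v \<in> carrier_vec p" "v \<noteq> 0\<^sub>v p" "mult_mat_vec B v = 0\<^sub>v p"
      using det_0_iff_vec_prod_zero[OF B(1)] by blast
    have "mult_mat_vec A v = (- s) \<cdot>\<^sub>v v"
    proof (rule eq_vecI)
      fix i assume "i < dim_vec ((- s) \<cdot>\<^sub>v v)"
      then have i: "i < p" using v by simp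
      have "vec_index (mult_mat_vec A v + s \<cdot>\<^sub>v v) i = 0"
        using v i Bv[OF v(1)] by simp
      then show "vec_index (mult_mat_vec A v) i = vec_index ((- s) \<cdot>\<^sub>v v) i"
        using v i A by simp
    qed (use A v in auto)
    then have "eigenvalue A (- s)"
      unfolding eigenvalue_def eigenvector_def using v A by auto
    with eig s0 show False by fastforce
  qed
  note C = mat_inv_det_nonzero[OF B(1) this]
  define C where "C = mat_inv B"
  obtain K where K: "0 < K" "\<And>x. x \<in> carrier_vec p \<Longrightarrow> \<bar>bilin x C x\<bar> \<le> K * scalar_prod x x"
    using bilin_bounded[OF C(1)] unfolding C_def by blast
  \<comment> \<open>Cauchy--Schwarz for \<open>B\<close> is applied to \<open>x\<close> and
    \<open>y = C x\<close> with \<open>C\<close> the inverse of \<open>B\<close>: then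
    \<open>B y = x\<close>, so the mixed term is the squared length of \<open>x\<close>, and the
    form at \<open>y\<close> is that of \<open>C\<close> at \<open>x\<close>, bounded through
    \<open>K\<close>.\<close>
  have coercive: "scalar_prod x x \<le> K * bilin x B x" if x: "x \<in> carrier_vec p" for x
  proof (cases "scalar_prod x x = 0")
    case True
    then show ?thesis using psd[OF x] BB[OF x] K(1) by simp
  next
    case False
    then have pos: "0 < scalar_prod x x" using scalar_prod_self_nonneg[of x] by simp
    define y where "y = mult_mat_vec C x"
    have y: "y \<in> carrier_vec p" using C(1) x unfolding y_def C_def by auto
    have By: "mult_mat_vec B y = x"
      unfolding y_def C_def using x C B(1)
      by (metis assoc_mult_mat_vec one_mult_mat_vec)
    have "(scalar_prod x x)\<^sup>2 = (bilin x B y)\<^sup>2" unfolding bilin_def By ..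
    also have "\<dots> \<le> bilin x B x * bilin y B y"
      by (rule bilin_Cauchy_Schwarz[OF B _ x y]) (use psd BB in auto)
    also have "bilin y B y = bilin x C x"
      unfolding bilin_def By y_def[symmetric] using comm_scalar_prod[OF x y] by simp
    also have "bilin x B x * bilin x C x \<le> bilin x B x * (K * scalar_prod x x)"
      using K(2)[OF x] psd[OF x] BB[OF x] by (intro mult_left_mono) auto
    finally show ?thesis using pos by (simp add: power2_eq_square ac_simps)
  qed
  have "s = 0"
  proof (rule ccontr)
    assume "s \<noteq> 0"
    \<comment> \<open>Coercivity leaves room to lower a positive shift by \<open>1 / K\<close>,
      which contradicts minimality; the maximum keeps \<open>r\<close> nonnegative and hence in
      \<open>S\<close>.\<close>
    define r where "r = max 0 (s - 1 / K)"
    have "0 \<le> bilin x A x + r * scalar_prod x x" if x: "x \<in> carrier_vec p" for x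
    proof -
      have "0 \<le> bilin x A x + (s - 1 / K) * scalar_prod x x"
        using coercive[OF x] K(1) BB[OF x] by (simp add: field_simps)
      also have "\<dots> \<le> bilin x A x + r * scalar_prod x x"
        unfolding r_def using scalar_prod_self_nonneg[of x] by (intro add_left_mono mult_right_mono) auto
      finally show ?thesis .
    qed
    then have "r \<in> S" by (auto simp: S_def r_def)
    then have "s \<le> r" unfolding s_def using bdd by (rule cInf_lower)
    with \<open>s \<noteq> 0\<close> s0 K(1) show False by (auto simp: r_def max_def split: if_splits)
  qed
  have "0 < bilin x A x" if "x \<in> carrier_vec p" "x \<noteq> 0\<^sub>v p" for x
  proof -
    have "0 < K * bilin x A x"
      using scalar_prod_self_pos[OF that] coercive[OF that(1)] BB[OF that(1)] \<open>s = 0\<close> by simp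
    with K(1) show ?thesis by (simp add: zero_less_mult_iff)
  qed
  with A show ?thesis by (auto simp: pos_def_def)
qed

text \<open>The spectrum is finite, so its \<open>Min\<close> bounds every eigenvalue from below.
  This turns membership in \<open>param_set\<close> into positive definiteness.\<close>

lemma pos_def_if_Lambda_min_pos:
  assumes A: "A \<in> carrier_mat p p" "transpose_mat A = A" and "0 < Lambda_min A"
  shows "pos_def p A"
proof (rule pos_def_if_eigenvalues_pos[OF A])
  fix k assume "eigenvalue A k"
  then have "k \<in> spectrum A" by (simp add: spectrum_def)
  then have "Lambda_min A \<le> k"
    unfolding Lambda_min_def using card_finite_spectrum(1)[OF A(1)] by (intro Min_le)
  with assms(3) show "0 < k" by simp
qed

section \<open>Rank-two perturbations in the direction \<open>H\<close>\<close>

text \<open>Sylvester's identity: the two block matrices \<open>?M\<close> and \<open>?L\<close>,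
  multiplied in either order, give block triangular matrices whose determinants are the two
  sides.\<close>

lemma det_one_plus_mult_swap:
  fixes U V :: "real Matrix.mat"
  assumes U: "U \<in> carrier_mat p q" and V: "V \<in> carrier_mat q p"
  shows "Determinant.det (1\<^sub>m p + U * V) = Determinant.det (1\<^sub>m q + V * U)"
proof -
  let ?M = "four_block_mat (1\<^sub>m p) (- U) V (1\<^sub>m q)"
  let ?L = "four_block_mat (1\<^sub>m p) U (0\<^sub>m q p) (1\<^sub>m q)"
  have M: "?M \<in> carrier_mat (p + q) (p + q)" and L: "?L \<in> carrier_mat (p + q) (p + q)" by auto
  have detL: "Determinant.det ?L = 1"
    using U by (subst det_four_block_mat_lower_left_zero[of _ p _ q]) auto
  have UU: "U + - U = 0\<^sub>m p q" using U by (intro eq_matI) auto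
  have MtL: "?M * ?L = four_block_mat (1\<^sub>m p) (0\<^sub>m p q) V (1\<^sub>m q + V * U)"
    using U V
    by (subst mult_four_block_mat[of _ p p _ q _ q _ _ p _ q])
      (auto simp: UU comm_add_mat[of _ q q])
  have LtM: "?L * ?M = four_block_mat (1\<^sub>m p + U * V) (0\<^sub>m p q) V (1\<^sub>m q)"
    using U V UU
    by (subst mult_four_block_mat[of _ p p _ q _ q _ _ p _ q])
      (auto simp: comm_add_mat[of "- U" p q])
  have "Determinant.det (1\<^sub>m p + U * V) = Determinant.det (?L * ?M)"
    unfolding LtM using U V by (subst det_four_block_mat_upper_right_zero[of _ p _ q]) auto
  also have "\<dots> = Determinant.det (?M * ?L)"
    using det_mult[OF L M] det_mult[OF M L] by simp
  also have "\<dots> = Determinant.det (1\<^sub>m q + V * U)"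
    unfolding MtL using U V by (subst det_four_block_mat_upper_right_zero[of _ p _ q]) auto
  finally show ?thesis .
qed

lemma det_2_mat:
  fixes A :: "real Matrix.mat"
  assumes A: "A \<in> carrier_mat 2 2"
  shows "Determinant.det A = A $$ (0, 0) * A $$ (1, 1) - A $$ (0, 1) * A $$ (1, 0)"
proof -
  have A': "A \<in> carrier_mat (Suc (Suc 0)) (Suc (Suc 0))" using A by (simp only: numeral_2_eq_2)
  have minor: "Determinant.det (mat_delete A i 0) = mat_delete A i 0 $$ (0, 0)" for i
    using A' by (intro det_single) (auto simp: mat_delete_def)
  have "Determinant.det A = (\<Sum>i<2. A $$ (i, 0) * cofactor A i 0)"
    by (rule laplace_expansion_column[OF A]) simp
  also have "\<dots> = A $$ (0, 0) * A $$ (1, 1) - A $$ (0, 1) * A $$ (1, 0)"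
    using A' by (simp add: numeral_2_eq_2 cofactor_def minor, simp add: mat_delete_def)
  finally show ?thesis .
qed

lemma det_one_plus_rank_two:
  fixes U V :: "real Matrix.mat"
  assumes "U \<in> carrier_mat p 2" "V \<in> carrier_mat 2 p"
  shows "Determinant.det (1\<^sub>m p + U * V) = (1 + (V * U) $$ (0, 0)) * (1 + (V * U) $$ (1, 1))
        - (V * U) $$ (0, 1) * (V * U) $$ (1, 0)"
proof -
  \<comment> \<open>the simplifier does not terminate on \<open>carrier_mat 2 2\<close>, so the dimension is kept abstract\<close>
  obtain q :: nat where q: "q = 2" by simp
  have U: "U \<in> carrier_mat p q" and V: "V \<in> carrier_mat q p" using assms by (simp_all only: q)
  have "0 < q" "1 < q" using q by auto
  moreover have "1\<^sub>m q + V * U \<in> carrier_mat q q" using U V by simp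
  ultimately show ?thesis
    using U V det_2_mat[of "1\<^sub>m q + V * U", folded q] det_one_plus_mult_swap[OF U V]
    by (simp del: index_mult_mat(1))
qed

section \<open>The direction matrix: entries, quadratic form, positivity and determinant\<close>

lemma index_mult_mat_sum:
  assumes "A \<in> carrier_mat n q" "B \<in> carrier_mat q m" "i < n" "j < m"
  shows "(A * B) $$ (i, j) = (\<Sum>k<q. A $$ (i, k) * B $$ (k, j))"
  using assms by (simp add: scalar_prod_def atLeast0LessThan)

text \<open>By symmetry of \<open>T\<close>, the product \<open>T u v^T T\<close> is the outer
  product of \<open>T u\<close> and \<open>T v\<close>, which exhibits the direction as a matrix of
  rank at most two.\<close>

lemma index_direction_of:
  assumes T: "T \<in> carrier_mat p p" "transpose_mat T = T"
    and u: "u \<in> carrier_vec p" and v: "v \<in> carrier_vec p" and ij: "i < p" "j < p"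
  shows "direction_of T u v $$ (i, j) =
    (vec_index (mult_mat_vec T u) i * vec_index (mult_mat_vec T v) j
     + vec_index (mult_mat_vec T v) i * vec_index (mult_mat_vec T u) j) / sigma_of T u v"
proof -
  have sym: "T $$ (k, l) = T $$ (l, k)" if "k < p" "l < p" for k l
    using T transpose_eq_self_iff that by blast
  have Tv: "vec_index (mult_mat_vec T w) k = (\<Sum>l<p. T $$ (k, l) * vec_index w l)"
    if "w \<in> carrier_vec p" "k < p" for w k
    using T that by (auto simp: scalar_prod_def atLeast0LessThan)
  let ?W = "outer_prod u v + outer_prod v u"
  have W: "?W \<in> carrier_mat p p" using u v by (auto simp: outer_prod_def)
  have "(T * ?W * T) $$ (i, j) = (\<Sum>l<p. (\<Sum>k<p. T $$ (i, k) * ?W $$ (k, l)) * T $$ (l, j))"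
    using T W ij
    by (subst index_mult_mat_sum[of _ p p _ p])
      (auto simp: index_mult_mat_sum[of _ p p _ p] simp del: index_mult_mat(1) intro!: sum.cong)
  also have "\<dots> = (\<Sum>l<p. (\<Sum>k<p. T $$ (i, k) * (vec_index u k * vec_index v l + vec_index v k * vec_index u l)) * T $$ (l, j))"
    using u v by (intro sum.cong refl arg_cong2[where f = "(*)"]) (auto simp: outer_prod_def)
  also have "\<dots> = (\<Sum>l<p. (vec_index (mult_mat_vec T u) i * vec_index v l + vec_index (mult_mat_vec T v) i * vec_index u l) * T $$ (j, l))"
    using ij u v
    by (intro sum.cong refl arg_cong2[where f = "(*)"])
      (auto simp: Tv sum_distrib_left sum_distrib_right sum.distrib algebra_simps intro: sym)
  also have "\<dots> = vec_index (mult_mat_vec T u) i * vec_index (mult_mat_vec T v) j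
     + vec_index (mult_mat_vec T v) i * vec_index (mult_mat_vec T u) j"
    using ij u v by (simp add: Tv[of _ j] sum_distrib_left sum.distrib algebra_simps)
  finally show ?thesis
    using T W ij unfolding direction_of_def by simp
qed

lemma direction_of_carrier:
  assumes "T \<in> carrier_mat p p" shows "direction_of T u v \<in> carrier_mat p p"
  using assms by (auto simp: direction_of_def)

lemma bilin_direction_of:
  assumes T: "T \<in> carrier_mat p p" "transpose_mat T = T"
    and u: "u \<in> carrier_vec p" and v: "v \<in> carrier_vec p"
    and x: "x \<in> carrier_vec p" and y: "y \<in> carrier_vec p"
  shows "bilin x (direction_of T u v) y =
    (bilin x T u * bilin y T v + bilin x T v * bilin y T u) / sigma_of T u v"
proof -
  have b: "bilin z T w = (\<Sum>i<p. vec_index z i * vec_index (mult_mat_vec T w) i)"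
    if "z \<in> carrier_vec p" "w \<in> carrier_vec p" for z w
    using T that by (auto simp: bilin_def scalar_prod_def atLeast0LessThan)
  have "bilin x (direction_of T u v) y = (\<Sum>i<p. \<Sum>j<p. vec_index x i *
      ((vec_index (mult_mat_vec T u) i * vec_index (mult_mat_vec T v) j
     + vec_index (mult_mat_vec T v) i * vec_index (mult_mat_vec T u) j) / sigma_of T u v) * vec_index y j)"
    unfolding bilin_eq_sum[OF direction_of_carrier[OF T(1)] x y]
    using T u v by (intro sum.cong refl) (simp add: index_direction_of)
  also have "\<dots> = (\<Sum>i<p. \<Sum>j<p. (vec_index x i * vec_index (mult_mat_vec T u) i) * (vec_index y j * vec_index (mult_mat_vec T v) j)
     + (vec_index x i * vec_index (mult_mat_vec T v) i) * (vec_index y j * vec_index (mult_mat_vec T u) j)) / sigma_of T u v"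
    unfolding sum_divide_distrib by (intro sum.cong refl) (simp add: algebra_simps)
  also have "\<dots> = (bilin x T u * bilin y T v + bilin x T v * bilin y T u) / sigma_of T u v"
    unfolding sum.distrib b[OF x u] b[OF y v] b[OF x v] b[OF y u] sum_product ..
  finally show ?thesis .
qed

lemma pos_def_bilin_nonneg:
  assumes "pos_def p A" "x \<in> carrier_vec p"
  shows "0 \<le> bilin x A x"
proof (cases "x = 0\<^sub>v p")
  case True
  then show ?thesis using assms scalar_prod_left_zero[of "mult_mat_vec A (0\<^sub>v p)" p]
    by (auto simp: bilin_def pos_def_def)
qed (use assms in \<open>auto simp: pos_def_def intro: less_imp_le\<close>)

lemma sigma_of_square:
  assumes "pos_def p T" "u \<in> carrier_vec p" "v \<in> carrier_vec p"
  shows "(sigma_of T u v)\<^sup>2 = bilin u T u * bilin v T v + (bilin u T v)\<^sup>2"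
  unfolding sigma_of_def using assms by (simp add: pos_def_bilin_nonneg)

text \<open>The target functional is linear in the precision matrix, so its increment is exact; the
  numerator of \<open>bilin u (direction_of T u v) v\<close> is the square of
  \<open>sigma_of T u v\<close>, and one factor cancels.\<close>

lemma bilin_shift_direction_of:
  assumes T: "pos_def p T" and u: "u \<in> carrier_vec p" and v: "v \<in> carrier_vec p"
  shows "bilin u (T + s \<cdot>\<^sub>m direction_of T u v) v = bilin u T v + s * sigma_of T u v"
proof -
  have T': "T \<in> carrier_mat p p" "transpose_mat T = T" using T by (auto simp: pos_def_def)
  have "bilin u (direction_of T u v) v = (sigma_of T u v)\<^sup>2 / sigma_of T u v"
    unfolding bilin_direction_of[OF T' u v u v] sigma_of_square[OF T u v]
    using bilin_commute[OF T' u v] by (simp add: power2_eq_square ac_simps)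
  then show ?thesis
    using T' u v direction_of_carrier[OF T'(1), of u v]
    by (simp add: bilin_add_mat[of _ p] bilin_smult_mat[of _ p] power2_eq_square)
qed

text \<open>The form of the direction is at most twice the form of \<open>T\<close> in absolute
  value, whence the threshold 1/2. It is needed for the alternative (shift \<open>s\<close>) and for
  the kernel of the squared likelihood ratio (shift \<open>2 * s\<close>).\<close>

lemma pos_def_shift_direction_of:
  assumes T: "pos_def p T" and u: "u \<in> carrier_vec p" and v: "v \<in> carrier_vec p"
    and s: "\<bar>s\<bar> < 1 / 2"
  shows "pos_def p (T + s \<cdot>\<^sub>m direction_of T u v)"
proof -
  have T': "T \<in> carrier_mat p p" "transpose_mat T = T" using T by (auto simp: pos_def_def)
  note H = direction_of_carrier[OF T'(1), of u v]
  let ?\<sigma> = "sigma_of T u v"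
  have smult: "transpose_mat (s \<cdot>\<^sub>m A) = s \<cdot>\<^sub>m transpose_mat A" for A :: "real Matrix.mat"
    by (intro eq_matI) auto
  have "transpose_mat (direction_of T u v) = direction_of T u v"
  proof (rule eq_matI)
    fix i j assume "i < dim_row (direction_of T u v)" "j < dim_col (direction_of T u v)"
    then have "i < p" "j < p" using H by auto
    then show "transpose_mat (direction_of T u v) $$ (i, j) = direction_of T u v $$ (i, j)"
      using H by (simp add: index_direction_of[OF T' u v] mult.commute add.commute)
  qed (use H in auto)
  then have sym: "transpose_mat (T + s \<cdot>\<^sub>m direction_of T u v) = T + s \<cdot>\<^sub>m direction_of T u v"
    using T' H by (simp add: transpose_add[of _ p p] smult)
  have "0 < bilin x (T + s \<cdot>\<^sub>m direction_of T u v) x" if x: "x \<in> carrier_vec p" "x \<noteq> 0\<^sub>v p" for x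
  proof -
    have pos: "0 < bilin x T x" using T x by (auto simp: pos_def_def)
    have CS: "(bilin x T w)\<^sup>2 \<le> bilin x T x * bilin w T w" if "w \<in> carrier_vec p" for w
      using bilin_Cauchy_Schwarz[OF T' pos_def_bilin_nonneg[OF T] x(1) that] .
    have nonneg: "0 \<le> ?\<sigma>" unfolding sigma_of_def
      using T u v by (simp add: pos_def_bilin_nonneg)
    \<comment> \<open>Cauchy--Schwarz for the pairs \<open>x, u\<close> and \<open>x, v\<close>,
      followed by \<open>bilin u T u * bilin v T v \<le> ?\<sigma>\<^sup>2\<close>.\<close>
    have "(bilin x T u * bilin x T v)\<^sup>2 \<le> (bilin x T x * bilin u T u) * (bilin x T x * bilin v T v)"
      unfolding power_mult_distrib using CS[OF u] CS[OF v] pos_def_bilin_nonneg[OF T] x u v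
      by (intro mult_mono) auto
    also have "\<dots> \<le> (bilin x T x * ?\<sigma>)\<^sup>2"
      using mult_left_mono[of "bilin u T u * bilin v T v" "(sigma_of T u v)\<^sup>2" "(bilin x T x)\<^sup>2"]
        sigma_of_square[OF T u v]
      by (simp add: power_mult_distrib power2_eq_square ac_simps)
    finally have "\<bar>bilin x T u * bilin x T v\<bar> \<le> bilin x T x * ?\<sigma>"
      using pos nonneg
      by (subst (asm) abs_le_square_iff[symmetric]) (simp add: abs_mult)
    \<comment> \<open>If \<open>?\<sigma> = 0\<close>, division by zero makes the left-hand side
      0.\<close>
    then have "\<bar>bilin x (direction_of T u v) x\<bar> \<le> 2 * bilin x T x"
      unfolding bilin_direction_of[OF T' u v x(1) x(1)]
      using pos nonneg by (cases "?\<sigma> = 0") (simp_all add: pos_divide_le_eq abs_mult mult.commute)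
    then have "\<bar>s * bilin x (direction_of T u v) x\<bar> \<le> \<bar>s\<bar> * (2 * bilin x T x)"
      unfolding abs_mult by (intro mult_left_mono) auto
    also have "\<dots> < bilin x T x" using s pos by simp
    finally show ?thesis
      using T' H x by (simp add: bilin_add_mat[of _ p] bilin_smult_mat[of _ p])
  qed
  with sym T' H show ?thesis by (auto simp: pos_def_def)
qed

text \<open>Factor the matrix as \<open>T * (1 + U * V)\<close> with \<open>U\<close> of two columns
  and \<open>V\<close> of two rows; Sylvester's identity leaves a determinant of size two.\<close>

lemma det_shift_direction_of:
  fixes s :: real
  assumes T: "pos_def p T" and u: "u \<in> carrier_vec p" and v: "v \<in> carrier_vec p"
  defines "t \<equiv> s / sigma_of T u v"
  shows "Determinant.det (T + s \<cdot>\<^sub>m direction_of T u v) =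
    Determinant.det T * ((1 + t * bilin u T v)\<^sup>2 - t\<^sup>2 * (bilin u T u * bilin v T v))"
proof -
  have T': "T \<in> carrier_mat p p" "transpose_mat T = T" using T by (auto simp: pos_def_def)
  note H = direction_of_carrier[OF T'(1), of u v]
  have sym: "T $$ (k, l) = T $$ (l, k)" if "k < p" "l < p" for k l
    using T' transpose_eq_self_iff that by blast
  \<comment> \<open>Index 0 carries \<open>v\<close> in \<open>w\<close> but \<open>u\<close> in
    \<open>U\<close>: this crossing puts the mixed terms \<open>bilin u T v\<close> on the diagonal
    of \<open>V * U\<close> and the pure ones off it.\<close>
  define w where "w i = mult_mat_vec T (if i = 0 then v else u)" for i :: nat
  define U where "U = Matrix.mat p 2 (\<lambda>(i, j). t * vec_index (if j = 0 then u else v) i)"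
  define V where "V = Matrix.mat 2 p (\<lambda>(i, j). vec_index (w i) j)"
  have U: "U \<in> carrier_mat p 2" and V: "V \<in> carrier_mat 2 p" by (auto simp: U_def V_def)
  have UV_carrier: "U * V \<in> carrier_mat p p" by (rule mult_carrier_mat[OF U V])
  then have M: "1\<^sub>m p + U * V \<in> carrier_mat p p" by simp
  have "T + s \<cdot>\<^sub>m direction_of T u v = T * (1\<^sub>m p + U * V)"
  proof (rule eq_matI)
    fix i j assume "i < dim_row (T * (1\<^sub>m p + U * V))" "j < dim_col (T * (1\<^sub>m p + U * V))"
    then have ij: "i < p" "j < p" using T' M by auto
    have UV: "(U * V) $$ (k, j) = t * (vec_index u k * vec_index (w 0) j + vec_index v k * vec_index (w 1) j)"
      if "k < p" for k
      unfolding index_mult_mat_sum[OF U V that ij(2)]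
      using that ij by (simp add: U_def V_def numeral_2_eq_2 algebra_simps)
    have "(T * (1\<^sub>m p + U * V)) $$ (i, j) = T $$ (i, j) + (T * (U * V)) $$ (i, j)"
      unfolding mult_add_distrib_mat[OF T'(1) one_carrier_mat UV_carrier] right_mult_one_mat[OF T'(1)]
      using carrier_matD[OF mult_carrier_mat[OF T'(1) UV_carrier]] ij by (intro index_add_mat(1)) simp_all
    also have "(T * (U * V)) $$ (i, j) = (\<Sum>k<p. T $$ (i, k) * (U * V) $$ (k, j))"
      by (rule index_mult_mat_sum[OF T'(1) UV_carrier ij])
    also have "\<dots> = t * (vec_index (mult_mat_vec T u) i * vec_index (w 0) j + vec_index (mult_mat_vec T v) i * vec_index (w 1) j)"
      using ij T' u v by (simp add: UV scalar_prod_def atLeast0LessThan sum_distrib_left sum_distrib_right sum.distrib algebra_simps)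
    also have "\<dots> = s * direction_of T u v $$ (i, j)"
      using ij by (simp add: index_direction_of[OF T' u v] w_def t_def)
    finally show "(T + s \<cdot>\<^sub>m direction_of T u v) $$ (i, j) = (T * (1\<^sub>m p + U * V)) $$ (i, j)"
      using ij T' H by simp
  qed (use T' H M in auto)
  then have "Determinant.det (T + s \<cdot>\<^sub>m direction_of T u v) = Determinant.det T * Determinant.det (1\<^sub>m p + U * V)"
    using det_mult[OF T'(1) M] by simp
  also have "Determinant.det (1\<^sub>m p + U * V) = (1 + t * bilin u T v)\<^sup>2 - t\<^sup>2 * (bilin u T u * bilin v T v)"
  proof -
    have VU: "(V * U) $$ (i, j) = t * bilin (if j = 0 then u else v) T (if i = 0 then v else u)"
      if "i < 2" "j < 2" for i j
    proof -
      have "(V * U) $$ (i, j) = (\<Sum>k<p. vec_index (w i) k * (t * vec_index (if j = 0 then u else v) k))"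
        unfolding index_mult_mat_sum[OF V U that] using that
        by (intro sum.cong) (auto simp: U_def V_def)
      also have "\<dots> = t * (\<Sum>k<p. vec_index (if j = 0 then u else v) k * vec_index (w i) k)"
        unfolding sum_distrib_left by (intro sum.cong) (auto simp: ac_simps)
      also have "\<dots> = t * bilin (if j = 0 then u else v) T (if i = 0 then v else u)"
        unfolding w_def bilin_def scalar_prod_def atLeast0LessThan dim_mult_mat_vec carrier_matD(1)[OF T'(1)] ..
      finally show ?thesis .
    qed
    have lt2: "0 < (2 :: nat)" "1 < (2 :: nat)" by simp_all
    have V_U: "(V * U) $$ (0, 0) = t * bilin u T v" "(V * U) $$ (1, 1) = t * bilin u T v"
      "(V * U) $$ (0, 1) = t * bilin v T v" "(V * U) $$ (1, 0) = t * bilin u T u"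
      using VU[of 0 0, OF lt2(1,1)] VU[of 1 1, OF lt2(2,2)] VU[of 0 1, OF lt2(1,2)] VU[of 1 0, OF lt2(2,1)]
        bilin_commute[OF T' u v]
      by (simp_all only: refl if_True if_False zero_neq_one one_neq_zero)
    show ?thesis
      unfolding det_one_plus_rank_two[OF U V] V_U by (simp add: power2_eq_square algebra_simps)
  qed
  finally show ?thesis .
qed

section \<open>Gaussian integrals\<close>

lemma bilin_vec_eq_sum:
  assumes "A \<in> carrier_mat p p"
  shows "bilin (Matrix.vec p x) A (Matrix.vec p x) = (\<Sum>i<p. \<Sum>j<p. x i * A $$ (i, j) * x j)"
  using assms by (subst bilin_eq_sum[of _ p p]) auto

lemma nn_integral_gaussian:
  fixes c k :: real
  assumes c: "0 < c"
  shows "(\<integral>\<^sup>+ y. ennreal (exp (- (c * (y + k)\<^sup>2) / 2)) \<partial>lborel) = ennreal (sqrt (2 * pi / c))"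
proof -
  have s: "0 < 1 / sqrt c" using c by simp
  have "exp (- (c * (y + k)\<^sup>2) / 2) = sqrt (2 * pi / c) * normal_density (- k) (1 / sqrt c) y" for y
    using c by (simp add: normal_density_def real_sqrt_divide field_simps)
  then have "(\<integral>\<^sup>+ y. ennreal (exp (- (c * (y + k)\<^sup>2) / 2)) \<partial>lborel)
      = (\<integral>\<^sup>+ y. ennreal (sqrt (2 * pi / c)) * ennreal (normal_density (- k) (1 / sqrt c) y) \<partial>lborel)"
    using c by (simp add: ennreal_mult)
  also have "\<dots> = ennreal (sqrt (2 * pi / c)) * (\<integral>\<^sup>+ y. ennreal (normal_density (- k) (1 / sqrt c) y) \<partial>lborel)"
    by (rule nn_integral_cmult) simp
  also have "(\<integral>\<^sup>+ y. ennreal (normal_density (- k) (1 / sqrt c) y) \<partial>lborel) = 1"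
    using integral_normal_density[OF s, of "- k"] integrable_normal_density[OF s, of "- k"]
    by (subst nn_integral_eq_integral) auto
  finally show ?thesis by simp
qed

section \<open>Schur complements and the Gaussian integral in several variables\<close>

definition schur_complement :: "nat \<Rightarrow> real Matrix.mat \<Rightarrow> real Matrix.mat" where
  "schur_complement p M = Matrix.mat p p (\<lambda>(i, j). M $$ (i, j) - M $$ (i, p) * M $$ (j, p) / M $$ (p, p))"

lemma schur_complement_carrier: "schur_complement p M \<in> carrier_mat p p"
  by (simp add: schur_complement_def)

text \<open>Completing the square in the last coordinate \<open>y\<close>; the Schur complement is
  the form left over in the other coordinates.\<close>

lemma bilin_schur_complement:
  fixes x :: "nat \<Rightarrow> real"
  assumes M: "M \<in> carrier_mat (Suc p) (Suc p)" "transpose_mat M = M" and c: "M $$ (p, p) \<noteq> 0"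
  shows "bilin (Matrix.vec (Suc p) (x(p := y))) M (Matrix.vec (Suc p) (x(p := y))) =
    M $$ (p, p) * (y + (\<Sum>i<p. M $$ (i, p) * x i) / M $$ (p, p))\<^sup>2
    + bilin (Matrix.vec p x) (schur_complement p M) (Matrix.vec p x)"
proof -
  let ?c = "M $$ (p, p)" and ?b = "\<Sum>i<p. M $$ (i, p) * x i"
  have sym: "M $$ (p, i) = M $$ (i, p)" if "i < p" for i
    using M transpose_eq_self_iff[OF M(1)] that by auto
  have "bilin (Matrix.vec (Suc p) (x(p := y))) M (Matrix.vec (Suc p) (x(p := y)))
      = (\<Sum>i<p. (\<Sum>j<p. x i * M $$ (i, j) * x j) + x i * M $$ (i, p) * y)
        + ((\<Sum>j<p. y * M $$ (p, j) * x j) + y * ?c * y)"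
    by (simp add: bilin_vec_eq_sum[OF M(1)])
  also have "(\<Sum>j<p. y * M $$ (p, j) * x j) = y * ?b"
    by (simp add: sum_distrib_left sym ac_simps)
  also have "(\<Sum>i<p. (\<Sum>j<p. x i * M $$ (i, j) * x j) + x i * M $$ (i, p) * y)
      = (\<Sum>i<p. \<Sum>j<p. x i * M $$ (i, j) * x j) + y * ?b"
    by (simp add: sum.distrib sum_distrib_left ac_simps)
  also have "(\<Sum>i<p. \<Sum>j<p. x i * M $$ (i, j) * x j) + y * ?b + (y * ?b + y * ?c * y)
      = (\<Sum>i<p. \<Sum>j<p. x i * M $$ (i, j) * x j) + 2 * y * ?b + ?c * y\<^sup>2"
    by (simp add: power2_eq_square)
  finally have lhs: "bilin (Matrix.vec (Suc p) (x(p := y))) M (Matrix.vec (Suc p) (x(p := y)))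
      = (\<Sum>i<p. \<Sum>j<p. x i * M $$ (i, j) * x j) + 2 * y * ?b + ?c * y\<^sup>2" .
  have "bilin (Matrix.vec p x) (schur_complement p M) (Matrix.vec p x)
      = (\<Sum>i<p. \<Sum>j<p. x i * M $$ (i, j) * x j - (M $$ (i, p) * x i) * (M $$ (j, p) * x j) / ?c)"
    unfolding bilin_vec_eq_sum[OF schur_complement_carrier]
    by (intro sum.cong refl) (simp add: schur_complement_def algebra_simps)
  also have "\<dots> = (\<Sum>i<p. \<Sum>j<p. x i * M $$ (i, j) * x j) - ?b\<^sup>2 / ?c"
    by (simp add: sum_subtractf power2_eq_square sum_product sum_divide_distrib)
  finally have rhs: "bilin (Matrix.vec p x) (schur_complement p M) (Matrix.vec p x)
      = (\<Sum>i<p. \<Sum>j<p. x i * M $$ (i, j) * x j) - ?b\<^sup>2 / ?c" .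
  have "S + 2 * y * b + ?c * y\<^sup>2 = ?c * (y + b / ?c)\<^sup>2 + (S - b\<^sup>2 / ?c)" for S b
    using c by (simp add: field_simps power2_eq_square)
  then show ?thesis unfolding lhs rhs .
qed

text \<open>Block elimination: \<open>M\<close> is an upper block triangular factor with diagonal
  blocks \<open>?S\<close> and \<open>?c\<close>, times a unipotent lower one.\<close>

lemma det_schur_complement:
  assumes M: "M \<in> carrier_mat (Suc p) (Suc p)" "transpose_mat M = M" and c: "M $$ (p, p) \<noteq> 0"
  shows "Determinant.det M = Determinant.det (schur_complement p M) * M $$ (p, p)"
proof -
  let ?c = "M $$ (p, p)"
  have sym: "M $$ (p, i) = M $$ (i, p)" if "i < p" for i
    using M transpose_eq_self_iff[OF M(1)] that by auto
  define B where "B = Matrix.mat p 1 (\<lambda>(i, _). M $$ (i, p))"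
  define R where "R = Matrix.mat 1 p (\<lambda>(_, j). M $$ (j, p) / ?c)"
  define C where "C = Matrix.mat 1 1 (\<lambda>_. ?c)"
  let ?S = "schur_complement p M"
  let ?U = "four_block_mat ?S B (0\<^sub>m 1 p) C"
  let ?L = "four_block_mat (1\<^sub>m p) (0\<^sub>m p 1) R (1\<^sub>m 1)"
  have cs: "B \<in> carrier_mat p 1" "R \<in> carrier_mat 1 p" "C \<in> carrier_mat 1 1" "?S \<in> carrier_mat p p"
    by (auto simp: B_def R_def C_def schur_complement_def)
  have blocks: "?U * ?L = four_block_mat (?S + B * R) B (C * R) C"
    using cs by (subst mult_four_block_mat[of _ p p _ 1 _ 1 _ _ p _ 1]) auto
  have "M = ?U * ?L"
    unfolding blocks
  proof (rule eq_matI)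
    fix i j
    assume "i < dim_row (four_block_mat (?S + B * R) B (C * R) C)" "j < dim_col (four_block_mat (?S + B * R) B (C * R) C)"
    then have "i \<le> p" "j \<le> p" using cs by auto
    then show "M $$ (i, j) = four_block_mat (?S + B * R) B (C * R) C $$ (i, j)"
      using M cs c
      by (cases "i = p"; cases "j = p")
        (auto simp: B_def R_def C_def schur_complement_def scalar_prod_def sym)
  qed (use M cs in auto)
  then have "Determinant.det M = Determinant.det ?U * Determinant.det ?L"
    using det_mult[OF four_block_carrier_mat[OF cs(4,3)] four_block_carrier_mat[OF one_carrier_mat one_carrier_mat]]
    by metis
  also have "Determinant.det ?L = 1"
    using cs by (subst det_four_block_mat_upper_right_zero[of _ p _ 1]) auto
  also have "Determinant.det ?U = Determinant.det ?S * ?c"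
    using cs by (subst det_four_block_mat_lower_left_zero[of _ p _ 1]) (auto simp: C_def det_single)
  finally show ?thesis by simp
qed

lemma pos_def_last_pos:
  assumes M: "pos_def (Suc p) M"
  shows "0 < M $$ (p, p)"
proof -
  have M': "M \<in> carrier_mat (Suc p) (Suc p)" using M by (simp add: pos_def_def)
  let ?e = "Matrix.vec (Suc p) (\<lambda>i. if i = p then 1 else 0 :: real)"
  have "vec_index ?e p \<noteq> vec_index (0\<^sub>v (Suc p)) p" by simp
  then have "?e \<noteq> 0\<^sub>v (Suc p)" by metis
  then have "0 < bilin ?e M ?e" using M by (simp add: pos_def_def)
  also have "bilin ?e M ?e = M $$ (p, p)"
    unfolding bilin_vec_eq_sum[OF M'] by simp
  finally show ?thesis .
qed

lemma pos_def_schur_complement: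
  assumes M: "pos_def (Suc p) M"
  shows "pos_def p (schur_complement p M)"
proof -
  have M': "M \<in> carrier_mat (Suc p) (Suc p)" "transpose_mat M = M" using M by (auto simp: pos_def_def)
  have c: "M $$ (p, p) \<noteq> 0" using pos_def_last_pos[OF M] by simp
  have "transpose_mat (schur_complement p M) = schur_complement p M"
    using M' transpose_eq_self_iff[OF M'(1)]
    by (subst transpose_eq_self_iff[OF schur_complement_carrier]) (auto simp: schur_complement_def)
  moreover have "0 < bilin z (schur_complement p M) z" if z: "z \<in> carrier_vec p" "z \<noteq> 0\<^sub>v p" for z
  proof -
    define x where "x = vec_index z"
    \<comment> \<open>This choice makes the completed square vanish, so the form of \<open>M\<close>
      at \<open>?w\<close> equals that of the Schur complement at \<open>z\<close>.\<close>
    define y where "y = - (\<Sum>i<p. M $$ (i, p) * x i) / M $$ (p, p)"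
    let ?w = "Matrix.vec (Suc p) (x(p := y))"
    have zx: "z = Matrix.vec p x" using z by (auto simp: x_def)
    have "z = 0\<^sub>v p" if "\<forall>i<p. x i = 0"
      using z(1) that by (intro eq_vecI) (auto simp: x_def)
    then obtain i where "i < p" "x i \<noteq> 0" using z(2) by blast
    then have "vec_index ?w i \<noteq> vec_index (0\<^sub>v (Suc p)) i" by simp
    then have "?w \<noteq> 0\<^sub>v (Suc p)" by metis
    then have "0 < bilin ?w M ?w" using M by (simp add: pos_def_def)
    then show ?thesis
      unfolding bilin_schur_complement[OF M' c] zx by (simp add: y_def)
  qed
  ultimately show ?thesis by (simp add: pos_def_def schur_complement_carrier)
qed

lemma measurable_bilin_vec [measurable]:
  fixes N :: "nat \<Rightarrow> real measure"
  assumes "A \<in> carrier_mat p p" "\<And>i. sets (N i) = sets borel"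
  shows "(\<lambda>x. bilin (Matrix.vec p x) A (Matrix.vec p x)) \<in> borel_measurable (\<Pi>\<^sub>M i\<in>{..<p}. N i)"
proof -
  have [measurable]: "(\<lambda>x. x i) \<in> borel_measurable (\<Pi>\<^sub>M i\<in>{..<p}. N i)" if "i < p" for i
    using measurable_component_singleton[of i "{..<p}" N] that assms(2)[of i]
    by (simp cong: measurable_cong_sets)
  show ?thesis
    unfolding bilin_vec_eq_sum[OF assms(1)] by measurable
qed

text \<open>Induction on the dimension: integrating out the last coordinate contributes
  \<open>sqrt (2 * pi / c)\<close> with \<open>c\<close> the last diagonal entry, and the
  determinant splits off the same \<open>c\<close>. Positivity of the determinant is carried along
  because the root of the quotient is formed at every stage.\<close>

lemma nn_integral_gaussian_form:
  assumes "pos_def p M"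
  shows "0 < Determinant.det M"
    and "(\<integral>\<^sup>+ x. ennreal (exp (- bilin (Matrix.vec p x) M (Matrix.vec p x) / 2)) \<partial>(\<Pi>\<^sub>M j\<in>{..<p}. lborel))
      = ennreal (sqrt ((2 * pi) ^ p / Determinant.det M))"
proof -
  interpret product_sigma_finite "\<lambda>_::nat. lborel :: real measure" by standard
  have "0 < Determinant.det M \<and>
    (\<integral>\<^sup>+ x. ennreal (exp (- bilin (Matrix.vec p x) M (Matrix.vec p x) / 2)) \<partial>(\<Pi>\<^sub>M j\<in>{..<p}. lborel))
      = ennreal (sqrt ((2 * pi) ^ p / Determinant.det M))"
    using assms
  proof (induction p arbitrary: M)
    case 0
    then have "M \<in> carrier_mat 0 0" by (simp add: pos_def_def)
    then show ?case by (simp add: bilin_def scalar_prod_def PiM_empty)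
  next
    case (Suc p)
    have M: "M \<in> carrier_mat (Suc p) (Suc p)" "transpose_mat M = M" using Suc.prems by (auto simp: pos_def_def)
    define c where "c = M $$ (p, p)"
    let ?S = "schur_complement p M"
    have c: "0 < c" unfolding c_def by (rule pos_def_last_pos[OF Suc.prems])
    then have c': "M $$ (p, p) \<noteq> 0" by (simp add: c_def)
    note IH = Suc.IH[OF pos_def_schur_complement[OF Suc.prems]]
    have det: "Determinant.det M = Determinant.det ?S * c"
      using det_schur_complement[OF M c'] by (simp add: c_def)
    have "(\<integral>\<^sup>+ x. ennreal (exp (- bilin (Matrix.vec (Suc p) x) M (Matrix.vec (Suc p) x) / 2)) \<partial>(\<Pi>\<^sub>M j\<in>{..<Suc p}. lborel))
      = (\<integral>\<^sup>+ x. (\<integral>\<^sup>+ y. ennreal (exp (- bilin (Matrix.vec (Suc p) (x(p := y))) M (Matrix.vec (Suc p) (x(p := y))) / 2)) \<partial>lborel)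
          \<partial>(\<Pi>\<^sub>M j\<in>{..<p}. lborel))"
      using measurable_bilin_vec[OF M(1), of "\<lambda>_. lborel"] unfolding lessThan_Suc
      by (intro product_nn_integral_insert) auto
    also have "\<dots> = (\<integral>\<^sup>+ x. ennreal (exp (- bilin (Matrix.vec p x) ?S (Matrix.vec p x) / 2)) * ennreal (sqrt (2 * pi / c))
          \<partial>(\<Pi>\<^sub>M j\<in>{..<p}. lborel))"
    proof (intro nn_integral_cong)
      fix x :: "nat \<Rightarrow> real"
      let ?k = "(\<Sum>i<p. M $$ (i, p) * x i) / c" and ?q = "bilin (Matrix.vec p x) ?S (Matrix.vec p x)"
      have "(\<integral>\<^sup>+ y. ennreal (exp (- bilin (Matrix.vec (Suc p) (x(p := y))) M (Matrix.vec (Suc p) (x(p := y))) / 2)) \<partial>lborel)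
        = (\<integral>\<^sup>+ y. ennreal (exp (- ?q / 2)) * ennreal (exp (- (c * (y + ?k)\<^sup>2) / 2)) \<partial>lborel)"
        unfolding bilin_schur_complement[OF M c'] c_def[symmetric]
        by (intro nn_integral_cong) (simp add: diff_divide_distrib flip: ennreal_mult exp_add)
      also have "\<dots> = ennreal (exp (- ?q / 2)) * ennreal (sqrt (2 * pi / c))"
        unfolding nn_integral_gaussian[OF c, of ?k, symmetric] by (rule nn_integral_cmult) simp
      finally show "(\<integral>\<^sup>+ y. ennreal (exp (- bilin (Matrix.vec (Suc p) (x(p := y))) M (Matrix.vec (Suc p) (x(p := y))) / 2)) \<partial>lborel)
        = ennreal (exp (- ?q / 2)) * ennreal (sqrt (2 * pi / c))" .
    qed
    also have "\<dots> = (\<integral>\<^sup>+ x. ennreal (exp (- bilin (Matrix.vec p x) ?S (Matrix.vec p x) / 2)) \<partial>(\<Pi>\<^sub>M j\<in>{..<p}. lborel))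
        * ennreal (sqrt (2 * pi / c))"
      using measurable_bilin_vec[OF schur_complement_carrier[of p M], of "\<lambda>_. lborel"]
      by (intro nn_integral_multc) auto
    also have "\<dots> = ennreal (sqrt ((2 * pi) ^ p / Determinant.det ?S)) * ennreal (sqrt (2 * pi / c))"
      using IH by simp
    also have "\<dots> = ennreal (sqrt ((2 * pi) ^ Suc p / Determinant.det M))"
      using IH c unfolding det by (simp add: mult.commute flip: ennreal_mult real_sqrt_mult)
    finally show ?case using IH c det by simp
  qed
  then show "0 < Determinant.det M"
    and "(\<integral>\<^sup>+ x. ennreal (exp (- bilin (Matrix.vec p x) M (Matrix.vec p x) / 2)) \<partial>(\<Pi>\<^sub>M j\<in>{..<p}. lborel))
      = ennreal (sqrt ((2 * pi) ^ p / Determinant.det M))" by auto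
qed

section \<open>The Chapman--Robbins inequality\<close>

text \<open>Integrability follows from \<open>\<bar>a * b\<bar> \<le> a\<^sup>2 + b\<^sup>2\<close>;
  the inequality is the discriminant condition for the integral of
  \<open>(f x + t * g x)\<^sup>2\<close>.\<close>

lemma Cauchy_Schwarz_integral:
  fixes f g :: "'a \<Rightarrow> real"
  assumes [measurable]: "f \<in> borel_measurable M" "g \<in> borel_measurable M"
    and f2: "integrable M (\<lambda>x. (f x)\<^sup>2)" and g2: "integrable M (\<lambda>x. (g x)\<^sup>2)"
  shows "integrable M (\<lambda>x. f x * g x)"
    and "(\<integral>x. f x * g x \<partial>M)\<^sup>2 \<le> (\<integral>x. (f x)\<^sup>2 \<partial>M) * (\<integral>x. (g x)\<^sup>2 \<partial>M)"
proof -
  show fg: "integrable M (\<lambda>x. f x * g x)"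
  proof (rule Bochner_Integration.integrable_bound[OF Bochner_Integration.integrable_add[OF f2 g2]])
    have "\<bar>a * b\<bar> \<le> a\<^sup>2 + b\<^sup>2" for a b :: real
    proof -
      have "2 * \<bar>a * b\<bar> \<le> a\<^sup>2 + b\<^sup>2"
        using sum_squares_bound[of "\<bar>a\<bar>" "\<bar>b\<bar>"] by (simp add: abs_mult mult.assoc)
      then show ?thesis using abs_ge_zero[of "a * b"] by linarith
    qed
    then show "AE x in M. norm (f x * g x) \<le> norm ((f x)\<^sup>2 + (g x)\<^sup>2)" by simp
  qed simp
  show "(\<integral>x. f x * g x \<partial>M)\<^sup>2 \<le> (\<integral>x. (f x)\<^sup>2 \<partial>M) * (\<integral>x. (g x)\<^sup>2 \<partial>M)"
  proof (rule quadratic_nonneg_discriminant)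
    fix t
    have "0 \<le> (\<integral>x. (f x + t * g x)\<^sup>2 \<partial>M)" by simp
    also have "\<dots> = (\<integral>x. (f x)\<^sup>2 + 2 * t * (f x * g x) + t\<^sup>2 * (g x)\<^sup>2 \<partial>M)"
      by (intro Bochner_Integration.integral_cong) (auto simp: power2_eq_square algebra_simps)
    also have "\<dots> = (\<integral>x. (f x)\<^sup>2 \<partial>M) + 2 * t * (\<integral>x. f x * g x \<partial>M) + t\<^sup>2 * (\<integral>x. (g x)\<^sup>2 \<partial>M)"
      using f2 g2 fg by simp
    finally show "0 \<le> \<dots>" .
  qed simp
qed

text \<open>The difference of the means is the covariance of \<open>T\<close> and \<open>L\<close>
  under \<open>P\<close>, and the variance of \<open>L\<close> is \<open>R - 1\<close> because
  \<open>L\<close> has mean one.\<close>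

lemma Chapman_Robbins:
  fixes L T :: "'a \<Rightarrow> real"
  assumes "prob_space P" and "prob_space (density P (\<lambda>x. ennreal (L x)))"
    and [measurable]: "L \<in> borel_measurable P" "T \<in> borel_measurable P"
    and nonneg: "\<And>x. 0 \<le> L x"
    and L2: "(\<integral>\<^sup>+ x. ennreal ((L x)\<^sup>2) \<partial>P) = ennreal R" and R: "0 \<le> R"
    and T2: "integrable P (\<lambda>x. (T x)\<^sup>2)"
  shows "((\<integral>x. T x \<partial>density P (\<lambda>x. ennreal (L x))) - (\<integral>x. T x \<partial>P))\<^sup>2
    \<le> (\<integral>x. (T x - (\<integral>x. T x \<partial>P))\<^sup>2 \<partial>P) * (R - 1)"
proof -
  interpret P: prob_space P by fact
  interpret Q: prob_space "density P (\<lambda>x. ennreal (L x))" by fact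
  let ?\<mu> = "\<integral>x. T x \<partial>P"
  have L2_int: "integrable P (\<lambda>x. (L x)\<^sup>2)"
    using L2 by (intro integrableI_nonneg) auto
  have L_int: "integrable P L"
    by (rule P.square_integrable_imp_integrable) (use L2_int in auto)
  have T_int: "integrable P T"
    by (rule P.square_integrable_imp_integrable) (use T2 in auto)
  have L1: "(\<integral>x. L x \<partial>P) = 1"
  proof -
    have "(\<integral>x. L x \<partial>P) = (\<integral>x. 1 \<partial>density P (\<lambda>x. ennreal (L x)))"
      using nonneg by (subst integral_density) auto
    then show ?thesis using Q.prob_space by simp
  qed
  have L2': "(\<integral>x. (L x)\<^sup>2 \<partial>P) = R"
    using L2 R L2_int by (subst integral_eq_nn_integral) auto
  have TL: "integrable P (\<lambda>x. T x * L x)"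
    by (rule Cauchy_Schwarz_integral(1)) (use T2 L2_int in auto)
  have f2: "integrable P (\<lambda>x. (T x - ?\<mu>)\<^sup>2)"
    using T2 T_int by (simp add: power2_diff)
  have g2: "integrable P (\<lambda>x. (L x - 1)\<^sup>2)"
    using L2_int L_int by (simp add: power2_diff)
  have "(\<integral>x. T x \<partial>density P (\<lambda>x. ennreal (L x))) = (\<integral>x. T x * L x \<partial>P)"
    using nonneg by (subst integral_density) (auto simp: mult.commute)
  \<comment> \<open>The two added terms \<open>- ?\<mu> * L x + ?\<mu>\<close> integrate to zero and
    complete the product of centred factors.\<close>
  also have "\<dots> - ?\<mu> = (\<integral>x. T x * L x - T x - ?\<mu> * L x + ?\<mu> \<partial>P)"
    using TL T_int L_int L1 P.prob_space by simp
  also have "\<dots> = (\<integral>x. (T x - ?\<mu>) * (L x - 1) \<partial>P)"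
    by (intro Bochner_Integration.integral_cong) (auto simp: algebra_simps)
  finally have "((\<integral>x. T x \<partial>density P (\<lambda>x. ennreal (L x))) - ?\<mu>)\<^sup>2
      \<le> (\<integral>x. (T x - ?\<mu>)\<^sup>2 \<partial>P) * (\<integral>x. (L x - 1)\<^sup>2 \<partial>P)"
    using Cauchy_Schwarz_integral(2)[OF _ _ f2 g2] by simp
  also have "(\<integral>x. (L x - 1)\<^sup>2 \<partial>P) = R - 1"
    using L2_int L_int L1 L2' P.prob_space by (simp add: power2_diff)
  finally show ?thesis .
qed

text \<open>A product measure is determined by its values on boxes, and there the product density
  and the indicator both factorise over the coordinates.\<close>

lemma PiM_density:
  fixes l :: "'a \<Rightarrow> real" and I :: "'i set"
  assumes N: "prob_space N" and Q: "prob_space (density N (\<lambda>x. ennreal (l x)))"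
    and [measurable]: "l \<in> borel_measurable N" and nonneg: "\<And>x. 0 \<le> l x" and I: "finite I"
  shows "(\<Pi>\<^sub>M i\<in>I. density N (\<lambda>x. ennreal (l x))) = density (\<Pi>\<^sub>M i\<in>I. N) (\<lambda>x. ennreal (\<Prod>i\<in>I. l (x i)))"
proof (rule sym)
  interpret N: product_sigma_finite "\<lambda>_::'i. N"
    by (rule product_sigma_finite.intro) (rule prob_space_imp_sigma_finite[OF N])
  interpret Q: product_sigma_finite "\<lambda>_::'i. density N (\<lambda>x. ennreal (l x))"
    by (rule product_sigma_finite.intro) (rule prob_space_imp_sigma_finite[OF Q])
  show "density (\<Pi>\<^sub>M i\<in>I. N) (\<lambda>x. ennreal (\<Prod>i\<in>I. l (x i))) = (\<Pi>\<^sub>M i\<in>I. density N (\<lambda>x. ennreal (l x)))"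
  proof (rule Q.PiM_eqI[OF I])
    show "sets (density (\<Pi>\<^sub>M i\<in>I. N) (\<lambda>x. ennreal (\<Prod>i\<in>I. l (x i)))) = sets (\<Pi>\<^sub>M i\<in>I. density N (\<lambda>x. ennreal (l x)))"
      by (auto intro!: sets_PiM_cong)
    fix A assume "\<And>i. i \<in> I \<Longrightarrow> A i \<in> sets (density N (\<lambda>x. ennreal (l x)))"
    then have A[measurable]: "\<And>i. i \<in> I \<Longrightarrow> A i \<in> sets N" by simp
    have "emeasure (density (\<Pi>\<^sub>M i\<in>I. N) (\<lambda>x. ennreal (\<Prod>i\<in>I. l (x i)))) (Pi\<^sub>E I A)
      = (\<integral>\<^sup>+ x. ennreal (\<Prod>i\<in>I. l (x i)) * indicator (Pi\<^sub>E I A) x \<partial>(\<Pi>\<^sub>M i\<in>I. N))"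
      using I A by (intro emeasure_density) (auto intro!: sets_PiM_I_finite)
    also have "\<dots> = (\<integral>\<^sup>+ x. (\<Prod>i\<in>I. ennreal (l (x i)) * indicator (A i) (x i)) \<partial>(\<Pi>\<^sub>M i\<in>I. N))"
    proof (intro nn_integral_cong)
      fix x assume "x \<in> space (\<Pi>\<^sub>M i\<in>I. N)"
      then have "indicator (Pi\<^sub>E I A) x = (\<Prod>i\<in>I. indicator (A i) (x i) :: ennreal)"
        using I by (auto simp: indicator_def space_PiM PiE_iff split: if_splits)
      then show "ennreal (\<Prod>i\<in>I. l (x i)) * indicator (Pi\<^sub>E I A) x = (\<Prod>i\<in>I. ennreal (l (x i)) * indicator (A i) (x i))"
        using nonneg by (simp add: prod.distrib prod_ennreal)
    qed
    also have "\<dots> = (\<Prod>i\<in>I. \<integral>\<^sup>+ y. ennreal (l y) * indicator (A i) y \<partial>N)"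
      by (intro N.product_nn_integral_prod I) auto
    also have "\<dots> = (\<Prod>i\<in>I. emeasure (density N (\<lambda>x. ennreal (l x))) (A i))"
      by (intro prod.cong refl) (auto simp: emeasure_density)
    finally show "emeasure (density (\<Pi>\<^sub>M i\<in>I. N) (\<lambda>x. ennreal (\<Prod>i\<in>I. l (x i)))) (Pi\<^sub>E I A)
      = (\<Prod>i\<in>I. emeasure (density N (\<lambda>x. ennreal (l x))) (A i))" .
  qed
qed

text \<open>The joint likelihood ratio is the product over the rows, so by independence its second
  moment is the power \<open>R ^ card I\<close>.\<close>

lemma Chapman_Robbins_iid:
  fixes l :: "'a \<Rightarrow> real" and T :: "('i \<Rightarrow> 'a) \<Rightarrow> real"
  assumes N: "prob_space N" and Q: "prob_space (density N (\<lambda>x. ennreal (l x)))"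
    and l[measurable]: "l \<in> borel_measurable N" and nonneg: "\<And>x. 0 \<le> l x"
    and l2: "(\<integral>\<^sup>+ x. ennreal ((l x)\<^sup>2) \<partial>N) = ennreal R" and R: "0 \<le> R" and I: "finite I"
    and T: "T \<in> borel_measurable (\<Pi>\<^sub>M i\<in>I. N)" and T2: "integrable (\<Pi>\<^sub>M i\<in>I. N) (\<lambda>x. (T x)\<^sup>2)"
  shows "((\<integral>x. T x \<partial>(\<Pi>\<^sub>M i\<in>I. density N (\<lambda>x. ennreal (l x)))) - (\<integral>x. T x \<partial>(\<Pi>\<^sub>M i\<in>I. N)))\<^sup>2
    \<le> (\<integral>x. (T x - (\<integral>x. T x \<partial>(\<Pi>\<^sub>M i\<in>I. N)))\<^sup>2 \<partial>(\<Pi>\<^sub>M i\<in>I. N)) * (R ^ card I - 1)"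
  unfolding PiM_density[OF N Q l nonneg I]
proof (rule Chapman_Robbins[OF _ _ _ T])
  interpret N: product_sigma_finite "\<lambda>_::'i. N"
    by (rule product_sigma_finite.intro) (rule prob_space_imp_sigma_finite[OF N])
  show "prob_space (\<Pi>\<^sub>M i\<in>I. N)" by (intro prob_space_PiM N)
  show "prob_space (density (\<Pi>\<^sub>M i\<in>I. N) (\<lambda>x. ennreal (\<Prod>i\<in>I. l (x i))))"
    unfolding PiM_density[OF N Q l nonneg I, symmetric] by (intro prob_space_PiM Q)
  have "(\<integral>\<^sup>+ x. ennreal ((\<Prod>i\<in>I. l (x i))\<^sup>2) \<partial>(\<Pi>\<^sub>M i\<in>I. N))
    = (\<integral>\<^sup>+ x. (\<Prod>i\<in>I. ennreal ((l (x i))\<^sup>2)) \<partial>(\<Pi>\<^sub>M i\<in>I. N))"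
    by (simp add: prod_ennreal prod_power_distrib)
  also have "\<dots> = (\<Prod>i\<in>I. \<integral>\<^sup>+ y. ennreal ((l y)\<^sup>2) \<partial>N)"
    by (intro N.product_nn_integral_prod I) auto
  also have "\<dots> = ennreal (R ^ card I)"
    using R by (simp add: l2 ennreal_power)
  finally show "(\<integral>\<^sup>+ x. ennreal ((\<Prod>i\<in>I. l (x i))\<^sup>2) \<partial>(\<Pi>\<^sub>M i\<in>I. N)) = ennreal (R ^ card I)" .
qed (use R T2 nonneg in \<open>auto intro!: prod_nonneg\<close>)

section \<open>Likelihood ratios of normal laws\<close>

text \<open>Parametrised by the precision matrix rather than the covariance, so that no inverse
  appears and the exponents of two laws combine linearly.\<close>

definition gauss_dens :: "nat \<Rightarrow> real Matrix.mat \<Rightarrow> (nat \<Rightarrow> real) \<Rightarrow> real" where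
  "gauss_dens p \<Theta> x = exp (- bilin (Matrix.vec p x) \<Theta> (Matrix.vec p x) / 2) * sqrt (Determinant.det \<Theta> / (2 * pi) ^ p)"

lemma measurable_gauss_dens [measurable]:
  assumes "pos_def p \<Theta>"
  shows "gauss_dens p \<Theta> \<in> borel_measurable (\<Pi>\<^sub>M j\<in>{..<p}. lborel)"
  using measurable_bilin_vec[of \<Theta> p "\<lambda>_. lborel"] assms
  unfolding gauss_dens_def by (auto simp: pos_def_def)

lemma normal_law_mat_inv:
  assumes "pos_def p \<Theta>"
  shows "normal_law p (mat_inv \<Theta>) = density (\<Pi>\<^sub>M j\<in>{..<p}. lborel) (\<lambda>x. ennreal (gauss_dens p \<Theta> x))"
proof -
  have \<Theta>: "\<Theta> \<in> carrier_mat p p" and det: "0 < Determinant.det \<Theta>"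
    using assms nn_integral_gaussian_form(1) by (auto simp: pos_def_def)
  then show ?thesis
    unfolding normal_law_def gauss_dens_def
    by (simp add: mat_inv_mat_inv[OF \<Theta>] det_mat_inv[OF \<Theta>] real_sqrt_divide)
qed

lemma sets_normal_law: "sets (normal_law p S) = sets (\<Pi>\<^sub>M j\<in>{..<p}. (borel :: real measure))"
  unfolding normal_law_def by (simp cong: sets_PiM_cong)

lemma prob_space_normal_law:
  assumes \<Theta>: "pos_def p \<Theta>"
  shows "prob_space (normal_law p (mat_inv \<Theta>))"
proof
  note [measurable] = measurable_gauss_dens[OF \<Theta>]
  have det: "0 < Determinant.det \<Theta>" by (rule nn_integral_gaussian_form(1)[OF \<Theta>])
  have "\<Theta> \<in> carrier_mat p p" using \<Theta> by (simp add: pos_def_def)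
  then have [measurable]: "(\<lambda>x. bilin (Matrix.vec p x) \<Theta> (Matrix.vec p x)) \<in> borel_measurable (\<Pi>\<^sub>M j\<in>{..<p}. lborel)"
    by (rule measurable_bilin_vec) simp
  have "emeasure (normal_law p (mat_inv \<Theta>)) (space (normal_law p (mat_inv \<Theta>)))
    = (\<integral>\<^sup>+ x. ennreal (gauss_dens p \<Theta> x) \<partial>(\<Pi>\<^sub>M j\<in>{..<p}. lborel))"
    unfolding normal_law_mat_inv[OF \<Theta>] by (subst emeasure_density) (auto intro!: nn_integral_cong simp: indicator_def)
  also have "\<dots> = (\<integral>\<^sup>+ x. ennreal (exp (- bilin (Matrix.vec p x) \<Theta> (Matrix.vec p x) / 2)) \<partial>(\<Pi>\<^sub>M j\<in>{..<p}. lborel))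
      * ennreal (sqrt (Determinant.det \<Theta> / (2 * pi) ^ p))"
    unfolding gauss_dens_def using det by (subst nn_integral_multc[symmetric]) (auto simp: ennreal_mult)
  also have "\<dots> = ennreal (sqrt ((2 * pi) ^ p / Determinant.det \<Theta>) * sqrt (Determinant.det \<Theta> / (2 * pi) ^ p))"
    unfolding nn_integral_gaussian_form(2)[OF \<Theta>] using det by (simp add: ennreal_mult)
  also have "\<dots> = 1"
    using det by (simp flip: real_sqrt_mult)
  finally show "emeasure (normal_law p (mat_inv \<Theta>)) (space (normal_law p (mat_inv \<Theta>))) = 1" .
qed

text \<open>For normal laws with precision matrices \<open>A\<close> and \<open>B\<close>, the square of the likelihood ratio times
  the first density is a Gaussian kernel with matrix \<open>C = 2 B - A\<close>.\<close>

lemma normal_law_likelihood_ratio: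
  assumes A: "pos_def p A" and B: "pos_def p B" and C: "pos_def p C"
    and ABC: "\<forall>x\<in>carrier_vec p. bilin x C x = 2 * bilin x B x - bilin x A x"
    and l_def: "l = (\<lambda>x. gauss_dens p B x / gauss_dens p A x)"
  shows "l \<in> borel_measurable (normal_law p (mat_inv A))"
    and "normal_law p (mat_inv B) = density (normal_law p (mat_inv A)) (\<lambda>x. ennreal (l x))"
    and "(\<integral>\<^sup>+ x. ennreal ((l x)\<^sup>2) \<partial>normal_law p (mat_inv A))
      = ennreal (Determinant.det B / sqrt (Determinant.det A * Determinant.det C))"
proof -
  let ?M = "\<Pi>\<^sub>M j\<in>{..<p}. (lborel :: real measure)"
  note [measurable] = measurable_gauss_dens[OF A] measurable_gauss_dens[OF B]
  have det: "0 < Determinant.det A" "0 < Determinant.det B" "0 < Determinant.det C"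
    using nn_integral_gaussian_form(1) A B C by auto
  have l[measurable]: "l \<in> borel_measurable ?M" unfolding l_def by measurable
  then show "l \<in> borel_measurable (normal_law p (mat_inv A))"
    unfolding normal_law_mat_inv[OF A] by simp
  have pos: "0 < gauss_dens p A x" "0 < gauss_dens p B x" for x
    using det by (auto simp: gauss_dens_def)
  have "density (normal_law p (mat_inv A)) (\<lambda>x. ennreal (l x))
    = density ?M (\<lambda>x. ennreal (gauss_dens p A x) * ennreal (l x))"
    unfolding normal_law_mat_inv[OF A] by (rule density_density_eq) auto
  also have "(\<lambda>x. ennreal (gauss_dens p A x) * ennreal (l x)) = (\<lambda>x. ennreal (gauss_dens p B x))"
    using pos by (auto simp: l_def less_imp_le less_imp_neq[symmetric] simp flip: ennreal_mult)
  finally show "normal_law p (mat_inv B) = density (normal_law p (mat_inv A)) (\<lambda>x. ennreal (l x))"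
    unfolding normal_law_mat_inv[OF B] ..
  have "C \<in> carrier_mat p p" using C by (simp add: pos_def_def)
  then have [measurable]: "(\<lambda>x. bilin (Matrix.vec p x) C (Matrix.vec p x)) \<in> borel_measurable ?M"
    by (rule measurable_bilin_vec) simp
  have W: "0 < (2 * pi) ^ p" by simp
  \<comment> \<open>Bookkeeping of normalising constants, with \<open>w\<close> standing for
    \<open>(2 * pi) ^ p\<close>: the first identity collects those of the densities, the second
    cancels \<open>w\<close> against the integral of the kernel.\<close>
  have sqrt_quotient: "(sqrt (b / w))\<^sup>2 / sqrt (a / w) = b / sqrt (a * w)"
    "sqrt (w / c) * (b / sqrt (a * w)) = b / sqrt (a * c)"
    if "0 < a" "0 < w" "0 < b" "0 < c" for a b c w :: real
  proof -
    have "(sqrt (b / w))\<^sup>2 / sqrt (a / w) = b * sqrt w / ((sqrt w)\<^sup>2 * sqrt a)"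
      using that by (simp add: real_sqrt_divide power_divide)
    also have "\<dots> = b / sqrt (a * w)"
      using that by (simp add: real_sqrt_mult power2_eq_square del: real_sqrt_mult_self)
    finally show "(sqrt (b / w))\<^sup>2 / sqrt (a / w) = b / sqrt (a * w)" .
    show "sqrt (w / c) * (b / sqrt (a * w)) = b / sqrt (a * c)"
      using that by (simp add: real_sqrt_mult real_sqrt_divide)
  qed
  let ?k = "Determinant.det B / sqrt (Determinant.det A * (2 * pi) ^ p)"
  have dens: "gauss_dens p A x * (l x)\<^sup>2 = exp (- bilin (Matrix.vec p x) C (Matrix.vec p x) / 2) * ?k" for x
  proof -
    let ?a = "bilin (Matrix.vec p x) A (Matrix.vec p x)" and ?b = "bilin (Matrix.vec p x) B (Matrix.vec p x)"
    have "gauss_dens p A x * (l x)\<^sup>2 = (gauss_dens p B x)\<^sup>2 / gauss_dens p A x"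
      using pos(1)[of x] by (simp add: l_def power2_eq_square)
    also have "\<dots> = (exp (- ?b / 2))\<^sup>2 / exp (- ?a / 2)
        * ((sqrt (Determinant.det B / (2 * pi) ^ p))\<^sup>2 / sqrt (Determinant.det A / (2 * pi) ^ p))"
      by (simp add: gauss_dens_def power_mult_distrib)
    \<comment> \<open>The exponents add up to \<open>- (2 * ?b - ?a) / 2\<close>, which is the
      kernel of \<open>C\<close> by \<open>ABC\<close>.\<close>
    also have "(exp (- ?b / 2))\<^sup>2 / exp (- ?a / 2) = exp (- bilin (Matrix.vec p x) C (Matrix.vec p x) / 2)"
      unfolding bspec[OF ABC vec_carrier] exp_double[symmetric] exp_diff[symmetric]
      by (rule arg_cong[of _ _ exp]) (simp add: field_simps)
    also have "(sqrt (Determinant.det B / (2 * pi) ^ p))\<^sup>2 / sqrt (Determinant.det A / (2 * pi) ^ p) = ?k"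
      by (rule sqrt_quotient(1)[OF det(1) W det(2,3)])
    finally show ?thesis .
  qed
  have "(\<integral>\<^sup>+ x. ennreal ((l x)\<^sup>2) \<partial>normal_law p (mat_inv A))
    = (\<integral>\<^sup>+ x. ennreal (gauss_dens p A x) * ennreal ((l x)\<^sup>2) \<partial>?M)"
    unfolding normal_law_mat_inv[OF A] by (rule nn_integral_density) auto
  also have "\<dots> = (\<integral>\<^sup>+ x. ennreal (exp (- bilin (Matrix.vec p x) C (Matrix.vec p x) / 2)) * ennreal ?k \<partial>?M)"
    using pos det dens by (intro nn_integral_cong) (simp add: less_imp_le flip: ennreal_mult)
  also have "\<dots> = (\<integral>\<^sup>+ x. ennreal (exp (- bilin (Matrix.vec p x) C (Matrix.vec p x) / 2)) \<partial>?M) * ennreal ?k"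
    by (rule nn_integral_multc) measurable
  also have "\<dots> = ennreal (sqrt ((2 * pi) ^ p / Determinant.det C) * ?k)"
    unfolding nn_integral_gaussian_form(2)[OF C] using det by (subst ennreal_mult) auto
  also have "sqrt ((2 * pi) ^ p / Determinant.det C) * ?k = Determinant.det B / sqrt (Determinant.det A * Determinant.det C)"
    by (rule sqrt_quotient(2)[OF det(1) W det(2,3)])
  finally show "(\<integral>\<^sup>+ x. ennreal ((l x)\<^sup>2) \<partial>normal_law p (mat_inv A))
      = ennreal (Determinant.det B / sqrt (Determinant.det A * Determinant.det C))" .
qed

section \<open>The asymptotic bound\<close>

text \<open>This is \<open>(2 + 4 * s + s\<^sup>2) / 2\<close> over a lower bound for the radicand,
  the half coming from the square root. It tends to 1 as \<open>s\<close> tends to 0, so the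
  logarithm of the second moment for one row is at most
  \<open>(1 + o(1)) * s\<^sup>2\<close>.\<close>

definition chi2_rate :: "real \<Rightarrow> real" where
  "chi2_rate s = (1 + 2 * s + s\<^sup>2 / 2) / (1 - 4 * s - 4 * s\<^sup>2)"

text \<open>Both factors are determinants of rank-two perturbations; with \<open>e = 2 a\<^sup>2 - 1\<close> the numerator is
  \<open>1 + 2 s a + s\<^sup>2 e\<close>, and its square exceeds the radicand by \<open>s\<^sup>2 (2 + 4 s a e + s\<^sup>2 e\<^sup>2)\<close>.\<close>

lemma row_second_moment_bound:
  fixes a s :: real
  assumes a: "a\<^sup>2 \<le> 1" and s: "0 < s" "s < 1 / 8"
  defines "N \<equiv> (1 + s * a)\<^sup>2 - s\<^sup>2 * (1 - a\<^sup>2)" and "D \<equiv> (1 + 2 * s * a)\<^sup>2 - (2 * s)\<^sup>2 * (1 - a\<^sup>2)"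
  shows "N / sqrt D \<le> exp (chi2_rate s * s\<^sup>2)"
proof -
  define e where "e = 2 * a\<^sup>2 - 1"
  have e: "\<bar>e\<bar> \<le> 1" using a zero_le_power2[of a] unfolding e_def by linarith
  have a': "\<bar>a\<bar> \<le> 1" using a by (simp add: abs_square_le_1)
  have ae: "\<bar>a * e\<bar> \<le> 1" using mult_mono[OF a' e] by (simp add: abs_mult)
  have e2: "e\<^sup>2 \<le> 1" using e by (simp add: abs_square_le_1)
  have N: "N = 1 + 2 * (s * a) + s\<^sup>2 * e" and D: "D = 1 + 4 * (s * a) + 4 * (s\<^sup>2 * e)"
    unfolding N_def D_def e_def by (simp_all add: power2_eq_square algebra_simps)
  have sa: "\<bar>s * a\<bar> \<le> s" using mult_left_mono[OF a', of s] s by (simp add: abs_mult)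
  have se: "\<bar>s\<^sup>2 * e\<bar> \<le> s\<^sup>2" using mult_left_mono[OF e, of "s\<^sup>2"] by (simp add: abs_mult)
  \<comment> \<open>The restriction \<open>s < 1 / 8\<close> pays off here:
    \<open>4 * s + 4 * s\<^sup>2\<close> is at most \<open>9 * s / 2 < 1\<close>, so the denominator
    \<open>d\<close> is positive.\<close>
  have s2: "s\<^sup>2 \<le> s / 8" using mult_left_mono[of s "1 / 8" s] s by (simp add: power2_eq_square)
  define d where "d = 1 - 4 * s - 4 * s\<^sup>2"
  have d: "0 < d" using s s2 unfolding d_def by linarith
  have dD: "d \<le> D" using sa se unfolding d_def D by linarith
  \<comment> \<open>The leading coefficient \<open>4 * a\<^sup>2 - 2 * e\<close> equals 2 whatever
    \<open>a\<close> is; this is the effect of normalising the direction by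
    \<open>sigma_of\<close>.\<close>
  have "N\<^sup>2 = D + s\<^sup>2 * (2 + 4 * (s * (a * e)) + s\<^sup>2 * e\<^sup>2)"
    unfolding N D e_def by (simp add: power2_eq_square algebra_simps)
  moreover have "s\<^sup>2 * (2 + 4 * (s * (a * e)) + s\<^sup>2 * e\<^sup>2) \<le> s\<^sup>2 * (2 + 4 * s + s\<^sup>2)"
  proof (intro mult_left_mono add_mono)
    show "s * (a * e) \<le> s" using mult_left_mono[of "a * e" 1 s] ae s by (simp add: abs_le_iff)
    show "s\<^sup>2 * e\<^sup>2 \<le> s\<^sup>2" using mult_left_mono[OF e2, of "s\<^sup>2"] by simp
  qed auto
  ultimately have "N\<^sup>2 \<le> D + s\<^sup>2 * (2 + 4 * s + s\<^sup>2)" by simp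
  then have "N\<^sup>2 / D \<le> 1 + s\<^sup>2 * (2 + 4 * s + s\<^sup>2) / D"
    using d dD by (simp add: field_simps)
  also have "\<dots> \<le> 1 + s\<^sup>2 * (2 + 4 * s + s\<^sup>2) / d"
    using s d dD by (intro add_left_mono divide_left_mono) auto
  also have "\<dots> = 1 + 2 * (chi2_rate s * s\<^sup>2)"
    unfolding chi2_rate_def d_def[symmetric] using d by (simp add: field_simps)
  \<comment> \<open>An exponential bound is chosen because it behaves well under the
    \<open>n\<close>-th power taken later.\<close>
  also have "\<dots> \<le> exp (2 * (chi2_rate s * s\<^sup>2))" by (rule exp_ge_add_one_self)
  also have "\<dots> = (exp (chi2_rate s * s\<^sup>2))\<^sup>2" by (rule exp_double)
  finally have "(N / sqrt D)\<^sup>2 \<le> (exp (chi2_rate s * s\<^sup>2))\<^sup>2"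
    using d dD by (simp add: power_divide)
  then show "N / sqrt D \<le> exp (chi2_rate s * s\<^sup>2)"
    by (rule power2_le_imp_le) simp
qed

text \<open>The kernel of the squared likelihood ratio between \<open>\<Theta>\<close> and
  \<open>\<Theta> + s H\<close> is \<open>2 (\<Theta> + s H) - \<Theta> = \<Theta> + 2 s H\<close>,
  again a shift along the direction, so all three determinants have the explicit rank-two
  form.\<close>

lemma variance_lower_bound_direction:
  assumes \<Theta>: "pos_def p \<Theta>" and u: "u \<in> carrier_vec p" and v: "v \<in> carrier_vec p"
    and \<sigma>: "sigma_of \<Theta> u v \<noteq> 0" and s: "0 < s" "s < 1 / 8"
    and t: "estimator n p t" and t2: "integrable (data_law n p \<Theta>) (\<lambda>x. (t x)\<^sup>2)"
  shows "(mean_under n p (\<Theta> + s \<cdot>\<^sub>m direction_of \<Theta> u v) t - mean_under n p \<Theta> t)\<^sup>2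
    \<le> var_under n p \<Theta> t * (exp (real n * chi2_rate s * s\<^sup>2) - 1)"
proof -
  let ?H = "direction_of \<Theta> u v" and ?\<sigma> = "sigma_of \<Theta> u v"
  let ?B = "\<Theta> + s \<cdot>\<^sub>m ?H" and ?C = "\<Theta> + (2 * s) \<cdot>\<^sub>m ?H"
  let ?N = "normal_law p (mat_inv \<Theta>)"
  define a where "a = bilin u \<Theta> v / ?\<sigma>"
  define l where "l = (\<lambda>x. gauss_dens p ?B x / gauss_dens p \<Theta> x)"
  define R where "R = Determinant.det ?B / sqrt (Determinant.det \<Theta> * Determinant.det ?C)"
  have \<Theta>': "\<Theta> \<in> carrier_mat p p" using \<Theta> by (simp add: pos_def_def)
  note H = direction_of_carrier[OF \<Theta>', of u v]
  have B: "pos_def p ?B" and C: "pos_def p ?C"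
    using s by (auto intro!: pos_def_shift_direction_of \<Theta> u v)
  have "\<forall>x\<in>carrier_vec p. bilin x ?C x = 2 * bilin x ?B x - bilin x \<Theta> x"
    using H \<Theta>' by (simp add: bilin_add_mat[of _ p] bilin_smult_mat[of _ p])
  note lr = normal_law_likelihood_ratio[OF \<Theta> B C this l_def, folded R_def]
  have detpos: "0 < Determinant.det \<Theta>" by (rule nn_integral_gaussian_form(1)[OF \<Theta>])
  \<comment> \<open>By definition of \<open>sigma_of\<close> the pure terms are determined by
    \<open>a\<close>, so the second moment \<open>R\<close> is a function of \<open>s\<close> and
    \<open>a\<close> alone, free of the dimension.\<close>
  have qq: "bilin u \<Theta> u * bilin v \<Theta> v / ?\<sigma>\<^sup>2 = 1 - a\<^sup>2"
  proof -
    have "bilin u \<Theta> u * bilin v \<Theta> v = ?\<sigma>\<^sup>2 - (bilin u \<Theta> v)\<^sup>2"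
      using sigma_of_square[OF \<Theta> u v] by simp
    then show ?thesis using \<sigma> by (simp add: a_def power_divide diff_divide_distrib)
  qed
  have a: "a\<^sup>2 \<le> 1"
  proof -
    have "0 \<le> bilin u \<Theta> u * bilin v \<Theta> v / ?\<sigma>\<^sup>2"
      using pos_def_bilin_nonneg[OF \<Theta>] u v by simp
    then show ?thesis unfolding qq by simp
  qed
  have det: "Determinant.det (\<Theta> + r \<cdot>\<^sub>m ?H) = Determinant.det \<Theta> * ((1 + r * a)\<^sup>2 - r\<^sup>2 * (1 - a\<^sup>2))" for r
    unfolding det_shift_direction_of[OF \<Theta> u v] qq[symmetric] by (simp add: a_def power_divide)
  have R_eq: "R = ((1 + s * a)\<^sup>2 - s\<^sup>2 * (1 - a\<^sup>2)) / sqrt ((1 + 2 * s * a)\<^sup>2 - (2 * s)\<^sup>2 * (1 - a\<^sup>2))"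
    unfolding R_def det using detpos by (simp add: real_sqrt_mult flip: mult.assoc)
  have R0: "0 \<le> R" unfolding R_def
    using nn_integral_gaussian_form(1) \<Theta> B C by (simp add: less_imp_le)
  have R1: "R \<le> exp (chi2_rate s * s\<^sup>2)"
    unfolding R_eq by (rule row_second_moment_bound[OF a s])
  have l0: "0 \<le> l x" for x
    unfolding l_def gauss_dens_def using nn_integral_gaussian_form(1) \<Theta> B by (simp add: less_imp_le)
  have law: "data_law n p \<Theta> = (\<Pi>\<^sub>M i\<in>{..<n}. ?N)"
    and law': "data_law n p ?B = (\<Pi>\<^sub>M i\<in>{..<n}. density ?N (\<lambda>x. ennreal (l x)))"
    unfolding data_law_def lr(2) by simp_all
  have "sets (\<Pi>\<^sub>M i\<in>{..<n}. ?N) = sets (\<Pi>\<^sub>M i\<in>{..<n}. \<Pi>\<^sub>M j\<in>{..<p}. (borel :: real measure))"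
    by (intro sets_PiM_cong sets_normal_law refl)
  then have t_meas: "t \<in> borel_measurable (\<Pi>\<^sub>M i\<in>{..<n}. ?N)"
    using t unfolding estimator_def by (simp cong: measurable_cong_sets)
  have Q: "prob_space (density ?N (\<lambda>x. ennreal (l x)))"
    using prob_space_normal_law[OF B] unfolding lr(2) .
  have "(mean_under n p ?B t - mean_under n p \<Theta> t)\<^sup>2 \<le> var_under n p \<Theta> t * (R ^ n - 1)"
    using Chapman_Robbins_iid[OF prob_space_normal_law[OF \<Theta>] Q lr(1) l0 lr(3) R0 finite_lessThan t_meas]
      t2 unfolding law
    by (simp add: mean_under_def var_under_def law law')
  also have "\<dots> \<le> var_under n p \<Theta> t * (exp (real n * chi2_rate s * s\<^sup>2) - 1)"
  proof (intro mult_left_mono diff_right_mono)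
    show "R ^ n \<le> exp (real n * chi2_rate s * s\<^sup>2)"
      using power_mono[OF R1 R0, of n] by (simp add: exp_of_nat_mult[symmetric] mult.assoc)
    show "0 \<le> var_under n p \<Theta> t" by (simp add: var_under_def)
  qed
  finally show ?thesis .
qed

section \<open>Passage to the limit\<close>

lemma chi2_rate_tendsto: "(s \<longlongrightarrow> 0) F \<Longrightarrow> ((\<lambda>n. chi2_rate (s n)) \<longlongrightarrow> 1) F"
  unfolding chi2_rate_def by (auto intro!: tendsto_eq_intros)

text \<open>The hypothesis reads \<open>(\<sigma> + \<delta>)\<^sup>2 \<le> n V (1 + o(1))\<close>.
  As \<open>n V\<close> is bounded, so is \<open>\<sigma>\<close>, and both errors vanish in the
  limit. The positive part is taken because the variance may exceed the bound; if
  \<open>\<sigma> n = 0\<close> it is 0.\<close>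

lemma asymptotic_variance_deficit:
  fixes V \<sigma> \<delta> m :: "nat \<Rightarrow> real"
  assumes V: "\<And>n. 0 \<le> V n" and VO: "V \<in> O(\<lambda>n. 1 / real n)"
    and m: "\<And>n. 0 < m n" and nm: "(\<lambda>n. real n) \<in> o(m)" and \<delta>: "\<delta> \<longlonglongrightarrow> 0"
    and bound: "\<forall>\<^sub>F n in sequentially. \<sigma> n \<noteq> 0 \<longrightarrow>
      (\<sigma> n + \<delta> n)\<^sup>2 / m n \<le> V n * (exp (real n * chi2_rate (1 / sqrt (m n)) / m n) - 1)"
  shows "(\<lambda>n. max 0 ((\<sigma> n)\<^sup>2 - real n * V n)) \<longlonglongrightarrow> 0"
proof -
  define y where "y n = real n / m n" for n
  define \<kappa> where "\<kappa> n = chi2_rate (1 / sqrt (m n))" for n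
  \<comment> \<open>From \<open>exp z - 1 \<le> z + z\<^sup>2\<close> with
    \<open>z = \<kappa> n * y n\<close>, whose right-hand side is \<open>y n * K n\<close>.\<close>
  define K where "K n = \<kappa> n + (\<kappa> n)\<^sup>2 * y n" for n
  have y: "y \<longlonglongrightarrow> 0" unfolding y_def by (rule smalloD_tendsto[OF nm])
  have "(\<lambda>n. 1 / m n) \<longlonglongrightarrow> 0"
  proof (rule tendsto_sandwich[OF _ _ tendsto_const y])
    show "\<forall>\<^sub>F n in sequentially. 1 / m n \<le> y n"
      using eventually_ge_at_top[of 1] by eventually_elim (use m in \<open>simp add: y_def divide_right_mono less_imp_le\<close>)
  qed (use m in \<open>simp add: less_imp_le\<close>)
  then have "(\<lambda>n. sqrt (1 / m n)) \<longlonglongrightarrow> sqrt 0" by (rule tendsto_real_sqrt)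
  then have \<kappa>: "\<kappa> \<longlonglongrightarrow> 1"
    unfolding \<kappa>_def by (intro chi2_rate_tendsto) (simp add: real_sqrt_divide)
  have K: "K \<longlonglongrightarrow> 1" unfolding K_def using \<kappa> y by (auto intro!: tendsto_eq_intros)
  have \<kappa>y: "(\<lambda>n. \<kappa> n * y n) \<longlonglongrightarrow> 0" using \<kappa> y by (auto intro!: tendsto_eq_intros)
  obtain b where b: "0 < b" "\<forall>\<^sub>F n in sequentially. norm (V n) \<le> b * norm (1 / real n)"
    using landau_o.bigE[OF VO] by blast
  \<comment> \<open>A bound for \<open>\<bar>\<sigma> n\<bar>\<close>: eventually
    \<open>K n < 2\<close> gives
    \<open>\<bar>\<sigma> n + \<delta> n\<bar> \<le> sqrt (2 * b)\<close>, and
    \<open>\<bar>\<delta> n\<bar> < 1\<close> supplies the summand 1.\<close>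
  define B where "B = sqrt (2 * b) + 1"
  have main: "\<forall>\<^sub>F n in sequentially. max 0 ((\<sigma> n)\<^sup>2 - real n * V n) \<le> b * \<bar>K n - 1\<bar> + 2 * B * \<bar>\<delta> n\<bar>"
    using bound b(2) eventually_ge_at_top[of 1]
      order_tendstoD(2)[OF K, of 2, simplified] order_tendstoD(1)[OF \<kappa>, of 0, simplified]
      order_tendstoD(2)[OF \<kappa>y, of 1, simplified]
      order_tendstoD(2)[OF tendsto_rabs_zero[OF \<delta>], of 1, simplified]
  proof eventually_elim
    case (elim n)
    have n: "0 < real n" and mn: "0 < m n" and y0: "0 \<le> y n" using elim m by (auto simp: y_def less_imp_le)
    have nV: "0 \<le> real n * V n" "real n * V n \<le> b"
      using elim V n by (auto simp: field_simps)
    have B: "0 \<le> B" using b by (simp add: B_def)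
    show ?case
    proof (cases "\<sigma> n = 0")
      case True
      then show ?thesis using nV b B by simp
    next
      case False
      let ?z = "\<kappa> n * y n"
      have z: "0 \<le> ?z" "?z \<le> 1" using elim y0 by auto
      have "exp ?z \<le> 1 + ?z + ?z\<^sup>2" by (rule exp_bound[OF z])
      then have "V n * (exp ?z - 1) \<le> V n * (y n * K n)"
        using V by (intro mult_left_mono) (auto simp: K_def power2_eq_square algebra_simps)
      moreover have "(\<sigma> n + \<delta> n)\<^sup>2 / m n \<le> V n * (exp ?z - 1)"
        using elim(1) False by (simp add: \<kappa>_def y_def mult.commute)
      ultimately have "(\<sigma> n + \<delta> n)\<^sup>2 / m n \<le> V n * (y n * K n)" by linarith
      then have sq: "(\<sigma> n + \<delta> n)\<^sup>2 \<le> (real n * V n) * K n"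
        using mn by (simp add: y_def field_simps)
      also have "\<dots> \<le> b * 2" using nV elim y0 b by (intro mult_mono) (auto simp: K_def)
      finally have "\<bar>\<sigma> n + \<delta> n\<bar> \<le> sqrt (2 * b)" by (simp add: real_le_rsqrt mult.commute)
      then have \<sigma>B: "\<bar>\<sigma> n\<bar> \<le> B" using elim unfolding B_def by linarith
      have "(\<sigma> n)\<^sup>2 - real n * V n = (\<sigma> n + \<delta> n)\<^sup>2 - real n * V n - 2 * (\<sigma> n * \<delta> n) - (\<delta> n)\<^sup>2"
        by (simp add: power2_eq_square algebra_simps)
      also have "\<dots> \<le> (real n * V n) * (K n - 1) + 2 * \<bar>\<sigma> n * \<delta> n\<bar>"
        using sq zero_le_power2[of "\<delta> n"] abs_ge_minus_self[of "\<sigma> n * \<delta> n"]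
        unfolding right_diff_distrib by linarith
      also have "\<dots> \<le> b * \<bar>K n - 1\<bar> + 2 * (B * \<bar>\<delta> n\<bar>)"
      proof (intro add_mono mult_left_mono)
        have "real n * V n * (K n - 1) \<le> real n * V n * \<bar>K n - 1\<bar>"
          using nV by (intro mult_left_mono) auto
        also have "\<dots> \<le> b * \<bar>K n - 1\<bar>" using nV by (intro mult_right_mono) auto
        finally show "real n * V n * (K n - 1) \<le> b * \<bar>K n - 1\<bar>" .
        show "\<bar>\<sigma> n * \<delta> n\<bar> \<le> B * \<bar>\<delta> n\<bar>" using \<sigma>B by (simp add: abs_mult mult_right_mono)
      qed simp
      finally show ?thesis using b B by simp
    qed
  qed
  have "(\<lambda>n. b * \<bar>K n - 1\<bar> + 2 * B * \<bar>\<delta> n\<bar>) \<longlonglongrightarrow> b * \<bar>1 - 1\<bar> + 2 * B * \<bar>0\<bar>"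
    using K \<delta> by (intro tendsto_intros)
  then have lim: "(\<lambda>n. b * \<bar>K n - 1\<bar> + 2 * B * \<bar>\<delta> n\<bar>) \<longlonglongrightarrow> 0" by simp
  show ?thesis
    by (rule tendsto_sandwich[OF _ main tendsto_const lim]) simp
qed

theorem theorem7:
  fixes p :: "nat \<Rightarrow> nat"
    and \<T> :: "nat \<Rightarrow> real Matrix.mat set"
    and d :: "nat \<Rightarrow> nat \<Rightarrow> real"
    and C1 C2 C3 c :: real
    and \<Sigma>\<^sub>0 \<Theta>\<^sub>0 H :: "nat \<Rightarrow> real Matrix.mat"
    and \<xi>\<^sub>1 \<xi>\<^sub>2 :: "nat \<Rightarrow> real Matrix.vec"
    and \<sigma> :: "nat \<Rightarrow> real"
    and T :: "nat \<Rightarrow> (nat \<Rightarrow> nat \<Rightarrow> real) \<Rightarrow> real"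
  assumes "\<And>n. 1 \<le> n \<Longrightarrow> 1 \<le> p n"
    and "\<And>n. 1 \<le> n \<Longrightarrow> \<T> n \<subseteq> carrier_mat (p n) (p n)"
    and "0 < C1" and "0 < C2" and "0 < C3" and "0 < c"
    and "\<And>n. 1 \<le> n \<Longrightarrow> \<Sigma>\<^sub>0 n \<in> carrier_mat (p n) (p n) \<and> invertible_mat (\<Sigma>\<^sub>0 n)"
    and "\<And>n. \<Theta>\<^sub>0 n = mat_inv (\<Sigma>\<^sub>0 n)"
    and "\<And>n. 1 \<le> n \<Longrightarrow> \<Theta>\<^sub>0 n \<in> param_set (p n) (\<T> n) (d n) C1 C2 C3"
    and "(\<lambda>n. Max (d n ` {..<p n}) * ln (real (p n))) \<in> o(\<lambda>n. sqrt (real n))"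
    and "\<And>n. 1 \<le> n \<Longrightarrow> \<xi>\<^sub>1 n \<in> carrier_vec (p n)"
    and "\<And>n. 1 \<le> n \<Longrightarrow> \<xi>\<^sub>2 n \<in> carrier_vec (p n)"
    and "\<And>n. \<sigma> n = sigma_of (\<Theta>\<^sub>0 n) (\<xi>\<^sub>1 n) (\<xi>\<^sub>2 n)"
    and "\<And>n. H n = direction_of (\<Theta>\<^sub>0 n) (\<xi>\<^sub>1 n) (\<xi>\<^sub>2 n)"
    and "\<And>n. 1 \<le> n \<Longrightarrow> \<Theta>\<^sub>0 n + (1 / sqrt (real n)) \<cdot>\<^sub>m H n
           \<in> param_ball (p n) (\<T> n) (d n) C1 C2 C3 (\<Theta>\<^sub>0 n) (c / sqrt (real n))"
    and "\<And>n. 1 \<le> n \<Longrightarrow> estimator n (p n) (T n)"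
    and "strongly_asymp_unbiased p T (\<lambda>n \<Theta>. bilin (\<xi>\<^sub>1 n) \<Theta> (\<xi>\<^sub>2 n)) \<Theta>\<^sub>0 H"
  shows "\<exists>r. r \<in> o(\<lambda>_. 1 :: real) \<and>
           (\<forall>n\<ge>1. var_under n (p n) (\<Theta>\<^sub>0 n) (T n) \<ge> ((\<sigma> n)\<^sup>2 - r n) / real n)"
proof -
  note \<Theta>\<^sub>0 = assms(9) and \<xi>\<^sub>1 = assms(11) and \<xi>\<^sub>2 = assms(12) and \<sigma> = assms(13) and H = assms(14)
    and est = assms(16) and unb = assms(17)
  define V where "V n = var_under n (p n) (\<Theta>\<^sub>0 n) (T n)" for n
  have V0: "0 \<le> V n" for n by (simp add: V_def var_under_def)
  have T2: "\<forall>\<^sub>F n in sequentially. integrable (data_law n (p n) (\<Theta>\<^sub>0 n)) (\<lambda>x. (T n x)\<^sup>2)"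
    and VO: "V \<in> O(\<lambda>n. 1 / real n)"
    using unb unfolding strongly_asymp_unbiased_def V_def by auto
  obtain m where m: "\<And>n. 0 < m n" "(\<lambda>n. real n) \<in> o(m)"
    and bias0: "(\<lambda>n. sqrt (m n) * (mean_under n (p n) (\<Theta>\<^sub>0 n) (T n) - bilin (\<xi>\<^sub>1 n) (\<Theta>\<^sub>0 n) (\<xi>\<^sub>2 n))) \<longlonglongrightarrow> 0"
    and bias1: "(\<lambda>n. sqrt (m n) * (mean_under n (p n) (\<Theta>\<^sub>0 n + (1 / sqrt (m n)) \<cdot>\<^sub>m H n) (T n)
        - bilin (\<xi>\<^sub>1 n) (\<Theta>\<^sub>0 n + (1 / sqrt (m n)) \<cdot>\<^sub>m H n) (\<xi>\<^sub>2 n))) \<longlonglongrightarrow> 0"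
    using unb unfolding strongly_asymp_unbiased_def by auto
  \<comment> \<open>The difference of the two scaled biases, which is exactly the error in replacing
    the increment of the mean by that of the target functional.\<close>
  define \<delta> where "\<delta> n = sqrt (m n) * (mean_under n (p n) (\<Theta>\<^sub>0 n + (1 / sqrt (m n)) \<cdot>\<^sub>m H n) (T n)
        - bilin (\<xi>\<^sub>1 n) (\<Theta>\<^sub>0 n + (1 / sqrt (m n)) \<cdot>\<^sub>m H n) (\<xi>\<^sub>2 n))
      - sqrt (m n) * (mean_under n (p n) (\<Theta>\<^sub>0 n) (T n) - bilin (\<xi>\<^sub>1 n) (\<Theta>\<^sub>0 n) (\<xi>\<^sub>2 n))" for n
  have \<delta>: "\<delta> \<longlonglongrightarrow> 0"
    using tendsto_diff[OF bias1 bias0] unfolding \<delta>_def by simp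
  \<comment> \<open>For \<open>n \<ge> 1\<close> this forces \<open>m n > 64\<close>, so the step
    \<open>1 / sqrt (m n)\<close> lies below the required 1/8.\<close>
  have small: "\<forall>\<^sub>F n in sequentially. real n / m n < 1 / 64"
    by (rule order_tendstoD(2)[OF smalloD_tendsto[OF m(2)]]) simp
  have "\<forall>\<^sub>F n in sequentially. \<sigma> n \<noteq> 0 \<longrightarrow>
      (\<sigma> n + \<delta> n)\<^sup>2 / m n \<le> V n * (exp (real n * chi2_rate (1 / sqrt (m n)) / m n) - 1)"
    using T2 small eventually_ge_at_top[of 1]
  proof eventually_elim
    case (elim n)
    show ?case
    proof
      assume nz: "\<sigma> n \<noteq> 0"
      let ?s = "1 / sqrt (m n)"
      have pd: "pos_def (p n) (\<Theta>\<^sub>0 n)"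
        using \<Theta>\<^sub>0[OF elim(3)] by (auto simp: param_set_def intro: pos_def_if_Lambda_min_pos)
      note \<xi> = \<xi>\<^sub>1[OF elim(3)] \<xi>\<^sub>2[OF elim(3)]
      have mn: "0 < sqrt (m n)" using m by simp
      have "64 * real n < m n" using elim(2) m(1)[of n] by (simp add: field_simps)
      then have "64 < m n" using elim(3) by simp
      then have "sqrt 64 < sqrt (m n)" by (rule real_sqrt_less_mono)
      moreover have "sqrt 64 = (8 :: real)" by (rule real_sqrt_unique) auto
      ultimately have s: "0 < ?s" "?s < 1 / 8" using mn by (simp_all add: field_simps)
      \<comment> \<open>The target functional grows by \<open>?s * \<sigma> n\<close>, which the
        factor \<open>sqrt (m n)\<close> scales to \<open>\<sigma> n\<close>.\<close>
      have "\<sigma> n + \<delta> n = sqrt (m n) * (mean_under n (p n) (\<Theta>\<^sub>0 n + ?s \<cdot>\<^sub>m H n) (T n) - mean_under n (p n) (\<Theta>\<^sub>0 n) (T n))"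
        unfolding \<delta>_def H bilin_shift_direction_of[OF pd \<xi>] \<sigma>[symmetric]
        using mn m(1)[of n] by (simp add: algebra_simps)
      then have "(\<sigma> n + \<delta> n)\<^sup>2 / m n
        = (mean_under n (p n) (\<Theta>\<^sub>0 n + ?s \<cdot>\<^sub>m H n) (T n) - mean_under n (p n) (\<Theta>\<^sub>0 n) (T n))\<^sup>2"
        using m(1)[of n] by (simp add: power_mult_distrib)
      also have "\<dots> \<le> V n * (exp (real n * chi2_rate ?s * ?s\<^sup>2) - 1)"
        unfolding H V_def
        by (rule variance_lower_bound_direction[OF pd \<xi> _ s est[OF elim(3)] elim(1)])
          (use nz in \<open>simp add: \<sigma>\<close>)
      also have "?s\<^sup>2 = 1 / m n" using m(1)[of n] by (simp add: power_divide)
      finally show "(\<sigma> n + \<delta> n)\<^sup>2 / m n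
          \<le> V n * (exp (real n * chi2_rate (1 / sqrt (m n)) / m n) - 1)" by simp
    qed
  qed
  \<comment> \<open>The remainder is the positive part of the deficit: with it the inequality holds
    for every \<open>n \<ge> 1\<close> by construction, and only its convergence to 0 is
    asymptotic.\<close>
  from asymptotic_variance_deficit[OF V0 VO m \<delta> this]
  have "(\<lambda>n. max 0 ((\<sigma> n)\<^sup>2 - real n * V n)) \<in> o(\<lambda>_. 1)"
    by (intro smalloI_tendsto) auto
  moreover have "V n \<ge> ((\<sigma> n)\<^sup>2 - max 0 ((\<sigma> n)\<^sup>2 - real n * V n)) / real n" if "1 \<le> n" for n
    using that by (auto simp: field_simps max_def)
  ultimately show ?thesis unfolding V_def by blast
qed

end
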